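(* Let $G$ be a PRS generator with output length $n(\lambda)\ge\log_2\lambda$. Then there exist a polynomial $t(\lambda)$ and a quantum algorithm $A=\{A_\lambda\}_\lambda$ (not efficient in general) such that $$\left|\Pr_{k\leftarrow\{0,1\}^\lambda}\left[A_\lambda\left(G_\lambda(k)^{\otimes t(\lambda)}\right)=1\right]-\Pr_{|\vartheta\rangle\leftarrow\mathscr H_{n(\lambda)}}\left[A_\lambda\left(|\vartheta\rangle\langle\vartheta|^{\otimes t(\lambda)}\right)=1\right]\right|\ge\frac13$$ for all sufficiently large $\lambda$.
   Context: $\mathscr H_n$ denotes the Haar probability measure on unit vectors of $(\mathbb C^2)^{\otimes n}$. A PRS generator with output length $n(\lambda)$ (polynomially bounded) is a QPT algorithm $G$ such that (1) for all $\lambda$ and all $k\in\{0,1\}^\lambda$, $G_\lambda(k)=|\psi_k\rangle\langle\psi_k|$ for some $n(\lambda)$-qubit pure state $|\psi_k\rangle$; (2) for every polynomial $t$ and every non-uniform QPT distinguisher $D$ (polynomial-size quantum circuits with quantum advice) there is a negligible $\varepsilon$ with $|\Pr_{k\leftarrow\{0,1\}^\lambda}[D_\lambda(G_\lambda(k)^{\otimes t(\lambda)})=1]-\Pr_{|\vartheta\rangle\leftarrow\mathscr H_{n(\lambda)}}[D_\lambda(|\vartheta\rangle^{\otimes t(\lambda)})=1]|\le\varepsilon(\lambda)$ for all $\lambda$. A quantum algorithm that is not necessarily efficient is an arbitrary family of quantum circuits/two-outcome measurements $A_\lambda$. *)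

theory Defs
  imports
    "HOL-Probability.Probability"
    "HOL-Computational_Algebra.Polynomial"
    "Jordan_Normal_Form.Schur_Decomposition"
begin

(* JNF's indexing of vectors by the infix dollar sign is used throughout. *)
unbundle no vec_syntax

section \<open>Linear algebra on qubit registers\<close>

text \<open>
  A register of \<open>n\<close> qubits is the space of complex vectors of dimension \<open>2 ^ n\<close>.
  Qubit \<open>0\<close> is the leftmost tensor factor, hence the most significant bit of an index.
\<close>

definition kron :: "complex mat \<Rightarrow> complex mat \<Rightarrow> complex mat" where
  "kron A B = mat (dim_row A * dim_row B) (dim_col A * dim_col B)
     (\<lambda>(i, j). A $$ (i div dim_row B, j div dim_col B) * B $$ (i mod dim_row B, j mod dim_col B))"

fun tensor_pow :: "complex mat \<Rightarrow> nat \<Rightarrow> complex mat" where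
  "tensor_pow A 0 = 1\<^sub>m 1"
| "tensor_pow A (Suc t) = kron A (tensor_pow A t)"

definition mat_trace :: "complex mat \<Rightarrow> complex" where
  "mat_trace A = (\<Sum>i<dim_row A. A $$ (i, i))"

text \<open>Trace over the second factor of a space of dimension \<open>d * r\<close>.\<close>

definition partial_trace :: "nat \<Rightarrow> nat \<Rightarrow> complex mat \<Rightarrow> complex mat" where
  "partial_trace d r A = mat d d (\<lambda>(i, j). \<Sum>l<r. A $$ (i * r + l, j * r + l))"

definition ket_bra :: "complex vec \<Rightarrow> complex mat" where
  "ket_bra v = mat (dim_vec v) (dim_vec v) (\<lambda>(i, j). v $ i * cnj (v $ j))"

text \<open>
  With the order on the complex numbers, \<open>0 \<le> z\<close> says that \<open>z\<close> is real and nonnegative;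
  in particular a positive semidefinite matrix is Hermitian.
\<close>

definition psd :: "nat \<Rightarrow> complex mat \<Rightarrow> bool" where
  "psd d A \<longleftrightarrow> A \<in> carrier_mat d d \<and> (\<forall>v \<in> carrier_vec d. 0 \<le> (A *\<^sub>v v) \<bullet>c v)"

definition density_operator :: "nat \<Rightarrow> complex mat \<Rightarrow> bool" where
  "density_operator n \<rho> \<longleftrightarrow> psd (2 ^ n) \<rho> \<and> mat_trace \<rho> = 1"

definition unitary_mat :: "nat \<Rightarrow> complex mat \<Rightarrow> bool" where
  "unitary_mat d U \<longleftrightarrow> U \<in> carrier_mat d d \<and> mat_adjoint U * U = 1\<^sub>m d"

definition pure_states :: "nat \<Rightarrow> complex vec set" where
  "pure_states n = {v \<in> carrier_vec (2 ^ n). v \<bullet>c v = 1}"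

text \<open>
  A two-outcome measurement on \<open>n\<close> qubits is given by the effect \<open>E\<close> of outcome 1; the effect of
  outcome 0 is \<open>1 - E\<close>, and outcome 1 has probability \<open>tr (E \<rho>)\<close>.
\<close>

definition two_outcome_measurement :: "nat \<Rightarrow> complex mat \<Rightarrow> bool" where
  "two_outcome_measurement n E \<longleftrightarrow> psd (2 ^ n) E \<and> psd (2 ^ n) (1\<^sub>m (2 ^ n) - E)"

definition outcome_prob :: "complex mat \<Rightarrow> complex mat \<Rightarrow> real" where
  "outcome_prob E \<rho> = Re (mat_trace (E * \<rho>))"


section \<open>Haar measure on pure states\<close>

text \<open>The \<open>\<sigma>\<close>-algebra generated by the coordinates, i.e. the Borel \<open>\<sigma>\<close>-algebra of the unit sphere.\<close>

definition pure_state_algebra :: "nat \<Rightarrow> complex vec measure" where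
  "pure_state_algebra n = sigma (pure_states n)
     {{v \<in> pure_states n. v $ i \<in> B} | i B. i < 2 ^ n \<and> B \<in> sets borel}"

text \<open>
  The Haar measure on states is the unitarily invariant Borel probability measure on the unit sphere; it
  exists and is unique since the unitary group is compact and acts transitively.
\<close>

definition haar_measure :: "nat \<Rightarrow> complex vec measure \<Rightarrow> bool" where
  "haar_measure n \<mu> \<longleftrightarrow>
     sets \<mu> = sets (pure_state_algebra n) \<and> prob_space \<mu> \<and>
     (\<forall>U. unitary_mat (2 ^ n) U \<longrightarrow> distr \<mu> \<mu> (\<lambda>v. U *\<^sub>v v) = \<mu>)"


section \<open>Quantum circuits\<close>

text \<open>Circuits over the universal gate set consisting of H, T and CNOT (control first).\<close>

datatype gate = Hadamard nat | Tgate nat | CNOT nat nat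

fun gate_wf :: "nat \<Rightarrow> gate \<Rightarrow> bool" where
  "gate_wf N (Hadamard i) \<longleftrightarrow> i < N"
| "gate_wf N (Tgate i) \<longleftrightarrow> i < N"
| "gate_wf N (CNOT c i) \<longleftrightarrow> c < N \<and> i < N \<and> c \<noteq> i"

definition proj0 :: "complex mat" where "proj0 = mat_of_rows_list 2 [[1, 0], [0, 0]]"
definition proj1 :: "complex mat" where "proj1 = mat_of_rows_list 2 [[0, 0], [0, 1]]"
definition pauliX :: "complex mat" where "pauliX = mat_of_rows_list 2 [[0, 1], [1, 0]]"
definition matH :: "complex mat" where
  "matH = complex_of_real (1 / sqrt 2) \<cdot>\<^sub>m mat_of_rows_list 2 [[1, 1], [1, -1]]"
definition matT :: "complex mat" where
  "matT = mat_of_rows_list 2 [[1, 0], [0, cis (pi / 4)]]"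

definition on_qubit :: "nat \<Rightarrow> nat \<Rightarrow> complex mat \<Rightarrow> complex mat" where
  "on_qubit N i u = kron (1\<^sub>m (2 ^ i)) (kron u (1\<^sub>m (2 ^ (N - Suc i))))"

fun gate_mat :: "nat \<Rightarrow> gate \<Rightarrow> complex mat" where
  "gate_mat N (Hadamard i) = on_qubit N i matH"
| "gate_mat N (Tgate i) = on_qubit N i matT"
| "gate_mat N (CNOT c i) = on_qubit N c proj0 + on_qubit N c proj1 * on_qubit N i pauliX"

text \<open>
  A circuit appends \<open>q_anc\<close> qubits in state \<open>|0>\<close> to its \<open>q_in\<close> input qubits, applies its gates in
  list order, and traces out all but the first \<open>q_out\<close> qubits. Intermediate measurements are
  covered by deferring them.
\<close>

record qcircuit =
  q_in :: nat
  q_anc :: nat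
  q_out :: nat
  gates :: "gate list"

definition qubits :: "qcircuit \<Rightarrow> nat" where
  "qubits C = q_in C + q_anc C"

definition circuit_wf :: "qcircuit \<Rightarrow> bool" where
  "circuit_wf C \<longleftrightarrow> q_out C \<le> qubits C \<and> (\<forall>g \<in> set (gates C). gate_wf (qubits C) g)"

definition circuit_size :: "qcircuit \<Rightarrow> nat" where
  "circuit_size C = qubits C + length (gates C)"

text \<open>The projector on the computational basis state labelled by a bit string.\<close>

fun basis_state :: "bool list \<Rightarrow> complex mat" where
  "basis_state [] = 1\<^sub>m 1"
| "basis_state (b # bs) = kron (if b then proj1 else proj0) (basis_state bs)"

definition circuit_mat :: "qcircuit \<Rightarrow> complex mat" where
  "circuit_mat C = fold (\<lambda>g V. gate_mat (qubits C) g * V) (gates C) (1\<^sub>m (2 ^ qubits C))"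

definition run_circuit :: "qcircuit \<Rightarrow> complex mat \<Rightarrow> complex mat" where
  "run_circuit C \<rho> = partial_trace (2 ^ q_out C) (2 ^ (qubits C - q_out C))
     (circuit_mat C * kron \<rho> (basis_state (replicate (q_anc C) False)) * mat_adjoint (circuit_mat C))"


section \<open>Polynomial-time uniformity\<close>

text \<open>
  Deterministic single-tape Turing machines on a two-way infinite tape. States and tape symbols are
  numbers, of which a machine with finitely many transitions uses finitely many. The start state is
  \<open>0\<close>; the machine halts when no transition applies. Symbols \<open>0\<close>, \<open>1\<close>, \<open>2\<close> are blank, bit 0, bit 1.
\<close>

datatype move = MLeft | MStay | MRight

type_synonym tm = "nat \<Rightarrow> nat \<Rightarrow> (nat \<times> nat \<times> move) option"
type_synonym tm_config = "nat \<times> (int \<Rightarrow> nat) \<times> int"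

fun shift :: "move \<Rightarrow> int" where
  "shift MLeft = -1"
| "shift MStay = 0"
| "shift MRight = 1"

fun tm_step :: "tm \<Rightarrow> tm_config \<Rightarrow> tm_config" where
  "tm_step M (q, tape, h) =
     (case M q (tape h) of
        None \<Rightarrow> (q, tape, h)
      | Some (q', s, d) \<Rightarrow> (q', tape(h := s), h + shift d))"

definition tape_of :: "bool list \<Rightarrow> int \<Rightarrow> nat" where
  "tape_of bs i = (if 0 \<le> i \<and> i < int (length bs) then (if bs ! nat i then 2 else 1) else 0)"

definition tm_outputs_within :: "tm \<Rightarrow> bool list \<Rightarrow> bool list \<Rightarrow> nat \<Rightarrow> bool" where
  "tm_outputs_within M inp out T \<longleftrightarrow>
     (\<exists>q h. (tm_step M ^^ T) (0, tape_of inp, 0) = (q, tape_of out, h) \<and> M q (tape_of out h) = None)"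

fun encode_gate :: "gate \<Rightarrow> nat list" where
  "encode_gate (Hadamard i) = [0, i]"
| "encode_gate (Tgate i) = [1, i]"
| "encode_gate (CNOT c i) = [2, c, i]"

text \<open>
  Numbers are encoded in unary, so that a polynomial-time machine can only describe circuits on
  polynomially many qubits.
\<close>

definition encode_circuit :: "qcircuit \<Rightarrow> bool list" where
  "encode_circuit C =
     concat (map (\<lambda>i. replicate i True @ [False])
       ([q_in C, q_anc C, q_out C] @ concat (map encode_gate (gates C))))"

text \<open>
  A QPT algorithm is a circuit family whose description is computed from \<open>1\<^sup>\<kappa>\<close> in polynomial time.
\<close>

definition QPT :: "(nat \<Rightarrow> qcircuit) \<Rightarrow> bool" where
  "QPT C \<longleftrightarrow> (\<forall>\<kappa>. circuit_wf (C \<kappa>)) \<and>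
     (\<exists>M (p :: nat poly). finite {(q, s). M q s \<noteq> None} \<and>
        (\<forall>\<kappa>. tm_outputs_within M (replicate \<kappa> True) (encode_circuit (C \<kappa>)) (poly p \<kappa>)))"


section \<open>Pseudorandom state generators\<close>

definition bitstrings :: "nat \<Rightarrow> bool list set" where
  "bitstrings m = {k. length k = m}"

definition negligible :: "(nat \<Rightarrow> real) \<Rightarrow> bool" where
  "negligible \<epsilon> \<longleftrightarrow> (\<forall>c::nat. \<forall>\<^sub>F \<kappa> in sequentially. \<bar>\<epsilon> \<kappa>\<bar> < 1 / real \<kappa> ^ c)"

text \<open>The state \<open>G\<^sub>\<kappa>(k)\<close> for a key \<open>k\<close> of length \<open>\<kappa>\<close>.\<close>

definition gen_state :: "(nat \<Rightarrow> qcircuit) \<Rightarrow> nat \<Rightarrow> bool list \<Rightarrow> complex mat" where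
  "gen_state G \<kappa> k = run_circuit (G \<kappa>) (basis_state k)"

text \<open>
  A nonuniform QPT distinguisher for inputs on \<open>m \<kappa>\<close> qubits: polynomial-size circuits \<open>D \<kappa>\<close> with one
  output qubit, together with an arbitrary advice state \<open>\<sigma> \<kappa>\<close> on \<open>a \<kappa>\<close> qubits. (The number of
  advice qubits is polynomial because it is bounded by the size of the circuit.)
\<close>

definition nonuniform_QPT_distinguisher ::
    "(nat \<Rightarrow> nat) \<Rightarrow> (nat \<Rightarrow> qcircuit) \<Rightarrow> (nat \<Rightarrow> nat) \<Rightarrow> (nat \<Rightarrow> complex mat) \<Rightarrow> bool" where
  "nonuniform_QPT_distinguisher m D a \<sigma> \<longleftrightarrow>
     (\<forall>\<kappa>. circuit_wf (D \<kappa>) \<and> q_in (D \<kappa>) = m \<kappa> + a \<kappa> \<and> q_out (D \<kappa>) = 1 \<and>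
          density_operator (a \<kappa>) (\<sigma> \<kappa>)) \<and>
     (\<exists>p :: nat poly. \<forall>\<kappa>. circuit_size (D \<kappa>) \<le> poly p \<kappa>)"

definition accept_prob :: "qcircuit \<Rightarrow> complex mat \<Rightarrow> complex mat \<Rightarrow> real" where
  "accept_prob D \<sigma> \<rho> = outcome_prob proj1 (run_circuit D (kron \<rho> \<sigma>))"

text \<open>\<open>H n\<close> is the Haar measure on \<open>n\<close>-qubit pure states, and \<open>n\<close> is the output length of \<open>G\<close>.\<close>

definition PRS_generator ::
    "(nat \<Rightarrow> complex vec measure) \<Rightarrow> (nat \<Rightarrow> nat) \<Rightarrow> (nat \<Rightarrow> qcircuit) \<Rightarrow> bool" where
  "PRS_generator H n G \<longleftrightarrow>
     QPT G \<and>
     (\<exists>p :: nat poly. \<forall>\<kappa>. n \<kappa> \<le> poly p \<kappa>) \<and>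
     (\<forall>\<kappa>. q_in (G \<kappa>) = \<kappa> \<and> q_out (G \<kappa>) = n \<kappa>) \<and>
     (\<forall>\<kappa>. \<forall>k \<in> bitstrings \<kappa>. \<exists>\<psi> \<in> pure_states (n \<kappa>). gen_state G \<kappa> k = ket_bra \<psi>) \<and>
     (\<forall>(t :: nat poly) D a \<sigma>.
        nonuniform_QPT_distinguisher (\<lambda>\<kappa>. poly t \<kappa> * n \<kappa>) D a \<sigma> \<longrightarrow>
        (\<exists>\<epsilon>. negligible \<epsilon> \<and>
          (\<forall>\<kappa>.
            \<bar>measure_pmf.expectation (pmf_of_set (bitstrings \<kappa>))
                (\<lambda>k. accept_prob (D \<kappa>) (\<sigma> \<kappa>) (tensor_pow (gen_state G \<kappa> k) (poly t \<kappa>)))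
             - (\<integral>\<theta>. accept_prob (D \<kappa>) (\<sigma> \<kappa>) (tensor_pow (ket_bra \<theta>) (poly t \<kappa>)) \<partial>H (n \<kappa>))\<bar>
            \<le> \<epsilon> \<kappa>)))"

end

theory Submission
  imports Defs
begin

text \<open>
  The test is the projector \<open>P\<close> onto the span of the states \<open>\<psi>\<^sub>k\<^sup>\<otimes>\<^sup>t\<close>, whose rank is at most \<open>2\<^sup>\<kappa>\<close>; it accepts
  every \<open>\<psi>\<^sub>k\<^sup>\<otimes>\<^sup>t\<close> with certainty. For the Haar moment \<open>M = E |\<theta>\<rangle>\<langle>\<theta>|\<^sup>\<otimes>\<^sup>t\<close>, Cauchy--Schwarz bounds the
  acceptance probability \<open>tr (P M)\<close> by the square root of \<open>tr (P\<^sup>2) tr (M\<^sup>2)\<close>, and unitary invariance gives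
  \<open>tr (M\<^sup>2) = K\<close>, where \<open>K = E |\<langle>\<theta>, v\<rangle>|\<^sup>2\<^sup>t\<close> is independent of the unit vector \<open>v\<close>.

  The exact value of \<open>K\<close>, and with it the representation theory of the symmetric subspace, is avoided.
  Applying the same inequality to \<open>\<Sum>\<^sub>a |u\<^sub>a\<rangle>\<langle>u\<^sub>a|\<^sup>\<otimes>\<^sup>t\<close>, for \<open>L\<close> unit vectors with pairwise overlaps at most \<open>\<delta>\<close>,
  yields \<open>(L K)\<^sup>2 \<le> (L + L\<^sup>2 \<delta>\<^sup>2\<^sup>t) K\<close>, that is \<open>K \<le> 1 / L + \<delta>\<^sup>2\<^sup>t\<close>. Vectors with \<open>\<kappa>\<close> coordinates that are
  fourth roots of unity, the first one being 1, give \<open>L = 4\<^sup>\<kappa>\<^sup>-\<^sup>1\<close> and \<open>\<delta> = 1 - 1 / (2 \<kappa>)\<close>, so \<open>t = 2 \<kappa>\<^sup>2\<close>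
  copies make \<open>2\<^sup>\<kappa> K\<close> negligible. The assumption on the output length only serves to provide \<open>\<kappa>\<close> coordinates.
\<close>

section \<open>Linear algebra\<close>

lemma mat_adjoint_index:
  "i < dim_col A \<Longrightarrow> j < dim_row A \<Longrightarrow> mat_adjoint A $$ (i, j) = cnj (A $$ (j, i))"
  by (simp add: mat_adjoint_def mat_of_rows_def)

lemma mat_adjoint_dims [simp]:
  "dim_row (mat_adjoint A) = dim_col A" "dim_col (mat_adjoint A) = dim_row A"
  by (simp_all add: mat_adjoint_def)

lemma mat_adjoint_carrier [simp]:
  "A \<in> carrier_mat m d \<Longrightarrow> mat_adjoint A \<in> carrier_mat d m"
  by (intro carrier_matI) simp_all

lemma mat_adjoint_mult:
  fixes A B :: "complex mat"
  assumes "dim_col A = dim_row B"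
  shows "mat_adjoint (A * B) = mat_adjoint B * mat_adjoint A"
  using assms
  by (intro eq_matI) (auto simp: mat_adjoint_index scalar_prod_def mult.commute)

lemma cscalar_prod_eq_sum:
  fixes v w :: "complex vec"
  assumes "v \<in> carrier_vec d" "w \<in> carrier_vec d"
  shows "v \<bullet>c w = (\<Sum>i<d. v $ i * cnj (w $ i))"
  using assms by (auto simp: scalar_prod_def atLeast0LessThan intro!: sum.cong)

lemma cnj_cscalar_prod:
  fixes v w :: "complex vec"
  assumes "v \<in> carrier_vec d" "w \<in> carrier_vec d"
  shows "cnj (v \<bullet>c w) = w \<bullet>c v"
  using assms by (simp add: cscalar_prod_eq_sum mult.commute)

lemma cscalar_prod_mat_adjoint:
  fixes v w :: "complex vec"
  assumes A: "A \<in> carrier_mat m d" and v: "v \<in> carrier_vec d" and w: "w \<in> carrier_vec m"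
  shows "(A *\<^sub>v v) \<bullet>c w = v \<bullet>c (mat_adjoint A *\<^sub>v w)"
proof -
  have "(A *\<^sub>v v) \<bullet>c w = (\<Sum>i<m. \<Sum>j<d. A $$ (i, j) * v $ j * cnj (w $ i))"
    using A v w by (subst cscalar_prod_eq_sum[of _ m])
      (auto simp: scalar_prod_def sum_distrib_right atLeast0LessThan intro!: sum.cong)
  also have "\<dots> = (\<Sum>j<d. \<Sum>i<m. A $$ (i, j) * v $ j * cnj (w $ i))"
    by (rule sum.swap)
  also have "\<dots> = (\<Sum>j<d. v $ j * cnj ((mat_adjoint A *\<^sub>v w) $ j))"
  proof (intro sum.cong refl)
    fix j assume j: "j \<in> {..<d}"
    hence "(mat_adjoint A *\<^sub>v w) $ j = (\<Sum>i<m. cnj (A $$ (i, j)) * w $ i)"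
      using A w by (auto simp: scalar_prod_def mat_adjoint_index atLeast0LessThan intro!: sum.cong)
    thus "(\<Sum>i<m. A $$ (i, j) * v $ j * cnj (w $ i)) = v $ j * cnj ((mat_adjoint A *\<^sub>v w) $ j)"
      by (simp add: sum_distrib_left mult_ac)
  qed
  also have "\<dots> = v \<bullet>c (mat_adjoint A *\<^sub>v w)"
    using mult_mat_vec_carrier[OF mat_adjoint_carrier[OF A] w]
    by (subst cscalar_prod_eq_sum[OF v]) simp_all
  finally show ?thesis .
qed

lemma dim_ket_bra [simp]:
  "dim_row (ket_bra v) = dim_vec v" "dim_col (ket_bra v) = dim_vec v"
  by (simp_all add: ket_bra_def)

lemma ket_bra_carrier [simp]: "v \<in> carrier_vec d \<Longrightarrow> ket_bra v \<in> carrier_mat d d"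
  by (auto simp: ket_bra_def)

lemma ket_bra_index [simp]:
  "i < dim_vec v \<Longrightarrow> j < dim_vec v \<Longrightarrow> ket_bra v $$ (i, j) = v $ i * cnj (v $ j)"
  by (simp add: ket_bra_def)

lemma mat_adjoint_ket_bra [simp]: "mat_adjoint (ket_bra v) = ket_bra v"
  by (intro eq_matI) (auto simp: mat_adjoint_index)

lemma smult_ket_bra_mult_vec:
  assumes v: "v \<in> carrier_vec d" and w: "w \<in> carrier_vec d"
  shows "(a \<cdot>\<^sub>m ket_bra v) *\<^sub>v w = (a * (w \<bullet>c v)) \<cdot>\<^sub>v v"
  using v w unfolding cscalar_prod_eq_sum[OF w v]
  by (intro eq_vecI) (simp_all add: scalar_prod_def sum_distrib_left atLeast0LessThan mult_ac)

lemma mult_ket_bra: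
  assumes "A \<in> carrier_mat m d" "v \<in> carrier_vec d"
  shows "A * ket_bra v = mat m d (\<lambda>(i, j). (A *\<^sub>v v) $ i * cnj (v $ j))"
  using assms
  by (intro eq_matI) (auto simp: scalar_prod_def sum_distrib_left mult_ac intro!: sum.cong)

text \<open>The scalar stays free because two normalisations occur:
  \<open>a = 1 / (v \<bullet>c v)\<close> gives an idempotent, for Gram-Schmidt, and
  \<open>a = 2 / (v \<bullet>c v)\<close> an operator whose square is twice itself, for a
  reflection.\<close>

lemma smult_ket_bra_square:
  assumes v: "v \<in> carrier_vec d"
  shows "(a \<cdot>\<^sub>m ket_bra v) * (a \<cdot>\<^sub>m ket_bra v) = (a * (v \<bullet>c v)) \<cdot>\<^sub>m (a \<cdot>\<^sub>m ket_bra v)"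
  using v unfolding cscalar_prod_eq_sum[OF v v]
  by (intro eq_matI) (auto simp: scalar_prod_def sum_distrib_left sum_distrib_right atLeast0LessThan
      mult_ac intro!: sum.cong)

lemma mat_trace_mult_ket_bra:
  assumes A: "A \<in> carrier_mat d d" and w: "w \<in> carrier_vec d"
  shows "mat_trace (A * ket_bra w) = (A *\<^sub>v w) \<bullet>c w"
  using A w by (subst cscalar_prod_eq_sum[of _ d])
    (auto simp: mult_ket_bra[OF A w] mat_trace_def intro!: sum.cong)

lemma cscalar_prod_mult_eq_sum:
  assumes "A \<in> carrier_mat d d" "w \<in> carrier_vec d"
  shows "(A *\<^sub>v w) \<bullet>c w = (\<Sum>i<d. \<Sum>j<d. A $$ (i, j) * (w $ j * cnj (w $ i)))"
  using assms by (subst cscalar_prod_eq_sum[of _ d])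
    (auto simp: scalar_prod_def sum_distrib_left atLeast0LessThan mult_ac intro!: sum.cong)

lemma cscalar_prod_self_nonneg: "0 \<le> v \<bullet>c (v :: complex vec)"
  by (rule conjugate_square_ge_0_vec)

section \<open>Orthogonal projectors, with the trace as their rank\<close>

definition projector :: "nat \<Rightarrow> complex mat \<Rightarrow> bool" where
  "projector d P \<longleftrightarrow> P \<in> carrier_mat d d \<and> mat_adjoint P = P \<and> P * P = P"

text \<open>Idempotence and self-adjointness turn the quadratic form at \<open>v\<close> into the
  squared norm of \<open>P *\<^sub>v v\<close>.\<close>

lemma projector_psd:
  assumes "projector d P"
  shows "psd d P"
  unfolding psd_def
proof (intro conjI ballI)
  show P: "P \<in> carrier_mat d d" using assms by (simp add: projector_def)
  fix v :: "complex vec" assume v: "v \<in> carrier_vec d"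
  have "(P *\<^sub>v v) \<bullet>c v = (P *\<^sub>v (P *\<^sub>v v)) \<bullet>c v"
    using assms P v by (metis assoc_mult_mat_vec projector_def)
  also have "\<dots> = (P *\<^sub>v v) \<bullet>c (P *\<^sub>v v)"
    using cscalar_prod_mat_adjoint[OF P _ v, of "P *\<^sub>v v"] assms P v
    by (simp add: projector_def)
  finally show "0 \<le> (P *\<^sub>v v) \<bullet>c v"
    by (simp add: cscalar_prod_self_nonneg)
qed

lemma mat_adjoint_minus:
  fixes A B :: "complex mat"
  assumes "A \<in> carrier_mat m d" "B \<in> carrier_mat m d"
  shows "mat_adjoint (A - B) = mat_adjoint A - mat_adjoint B"
  using assms by (intro eq_matI) (auto simp: mat_adjoint_index)

lemma mat_adjoint_add:
  fixes A B :: "complex mat"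
  assumes "A \<in> carrier_mat m d" "B \<in> carrier_mat m d"
  shows "mat_adjoint (A + B) = mat_adjoint A + mat_adjoint B"
  using assms by (intro eq_matI) (auto simp: mat_adjoint_index)

lemma mat_adjoint_smult:
  fixes A :: "complex mat"
  shows "mat_adjoint (c \<cdot>\<^sub>m A) = cnj c \<cdot>\<^sub>m mat_adjoint A"
  by (intro eq_matI) (auto simp: mat_adjoint_index)

lemma mat_adjoint_one [simp]: "mat_adjoint (1\<^sub>m d :: complex mat) = 1\<^sub>m d"
  by (intro eq_matI) (auto simp: mat_adjoint_index)

text \<open>The bracket \<open>A - A * A\<close> is kept apart to serve two cases: it vanishes for a
  projector, and equals \<open>-A\<close> when \<open>A * A\<close> is twice \<open>A\<close>, which
  leaves the identity.\<close>

lemma one_minus_square: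
  fixes A :: "complex mat"
  assumes A: "A \<in> carrier_mat d d"
  shows "(1\<^sub>m d - A) * (1\<^sub>m d - A) = 1\<^sub>m d - A - (A - A * A)"
proof -
  have C: "1\<^sub>m d - A \<in> carrier_mat d d" by (rule minus_carrier_mat[OF A])
  have "(1\<^sub>m d - A) * (1\<^sub>m d - A) = 1\<^sub>m d * (1\<^sub>m d - A) - A * (1\<^sub>m d - A)"
    by (rule minus_mult_distrib_mat[OF one_carrier_mat A C])
  also have "A * (1\<^sub>m d - A) = A * 1\<^sub>m d - A * A"
    by (rule mult_minus_distrib_mat[OF A one_carrier_mat A])
  also have "1\<^sub>m d * (1\<^sub>m d - A) = 1\<^sub>m d - A" by (rule left_mult_one_mat[OF C])
  also have "A * 1\<^sub>m d = A" by (rule right_mult_one_mat[OF A])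
  finally show ?thesis .
qed

lemma projector_complement:
  assumes "projector d P"
  shows "projector d (1\<^sub>m d - P)"
proof -
  have P: "P \<in> carrier_mat d d" "mat_adjoint P = P" "P * P = P"
    using assms by (auto simp: projector_def)
  have "(1\<^sub>m d - P) * (1\<^sub>m d - P) = 1\<^sub>m d - P"
    using one_minus_square[OF P(1)] P by auto
  moreover have "mat_adjoint (1\<^sub>m d - P) = 1\<^sub>m d - P"
    using P(1,2) by (subst mat_adjoint_minus[of _ d d]) simp_all
  ultimately show ?thesis using P(1) unfolding projector_def by (intro conjI minus_carrier_mat) simp_all
qed

lemma two_outcome_measurement_projector:
  "projector (2 ^ m) P \<Longrightarrow> two_outcome_measurement m P"
  by (simp add: two_outcome_measurement_def projector_psd projector_complement)

lemma mat_trace_add: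
  "A \<in> carrier_mat d d \<Longrightarrow> B \<in> carrier_mat d d \<Longrightarrow> mat_trace (A + B) = mat_trace A + mat_trace B"
  by (auto simp: mat_trace_def sum.distrib)

lemma mat_trace_smult: "A \<in> carrier_mat d d \<Longrightarrow> mat_trace (c \<cdot>\<^sub>m A) = c * mat_trace A"
  by (auto simp: mat_trace_def sum_distrib_left)

lemma mat_trace_ket_bra:
  assumes "v \<in> carrier_vec d"
  shows "mat_trace (ket_bra v) = v \<bullet>c v"
  using assms by (subst cscalar_prod_eq_sum[of _ d]) (auto simp: mat_trace_def)

text \<open>The square of the Hilbert-Schmidt norm; for a projector it equals the trace, hence the
  rank.\<close>

definition frob :: "complex mat \<Rightarrow> real" where
  "frob A = (\<Sum>i<dim_row A. \<Sum>j<dim_col A. (cmod (A $$ (i, j)))\<^sup>2)"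

lemma frob_eq_trace:
  "complex_of_real (frob A) = mat_trace (A * mat_adjoint A)"
  unfolding frob_def mat_trace_def
  by (auto simp: scalar_prod_def mat_adjoint_index complex_norm_square atLeast0LessThan
      simp del: of_real_power intro!: sum.cong)

text \<open>The trace stands in for the rank: it grows by one, or by nothing if \<open>v\<close> is
  already in the range, so inserting vectors one at a time bounds it by their number.\<close>

lemma projector_extend:
  assumes P: "projector d P" and v: "v \<in> carrier_vec d"
  obtains Q where "projector d Q" "Q *\<^sub>v v = v"
    "\<And>u. u \<in> carrier_vec d \<Longrightarrow> P *\<^sub>v u = u \<Longrightarrow> Q *\<^sub>v u = u"
    "mat_trace Q = mat_trace P \<or> mat_trace Q = mat_trace P + 1"
proof (cases "P *\<^sub>v v = v")
  case True
  then show ?thesis using P that by blast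
next
  case False
  have PC: "P \<in> carrier_mat d d" and PA: "mat_adjoint P = P" and PP: "P * P = P"
    using P by (auto simp: projector_def)
  \<comment> \<open>Gram--Schmidt: add the projector onto the component of \<open>v\<close> orthogonal to the range of \<open>P\<close>.\<close>
  define w where "w = v - P *\<^sub>v v"
  define c where "c = w \<bullet>c w"
  have w: "w \<in> carrier_vec d" using v PC by (auto simp: w_def)
  have "w \<noteq> 0\<^sub>v d"
  proof
    assume "w = 0\<^sub>v d"
    hence "\<And>i. i < d \<Longrightarrow> v $ i = (P *\<^sub>v v) $ i"
      using v PC unfolding w_def by (metis carrier_matD(1) dim_mult_mat_vec eq_iff_diff_eq_0 index_minus_vec(1) index_zero_vec(1))
    hence "P *\<^sub>v v = v" using v PC by (intro eq_vecI) auto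
    thus False using False by simp
  qed
  hence c0: "c \<noteq> 0" using w unfolding c_def by simp
  have cr: "cnj c = c" unfolding c_def by (rule cnj_cscalar_prod[OF w w])
  have PPv: "P *\<^sub>v (P *\<^sub>v v) = P *\<^sub>v v"
    using PC PP v by (metis assoc_mult_mat_vec)
  have Pw: "P *\<^sub>v w = 0\<^sub>v d"
    using PC v PPv unfolding w_def by (subst mult_minus_distrib_mat_vec) auto
  \<comment> \<open>The self-adjoint \<open>P\<close> annihilates \<open>w\<close>, so
    \<open>w\<close> is orthogonal to every vector that \<open>P\<close> fixes.\<close>
  have orth: "u \<bullet>c w = 0" if u: "u \<in> carrier_vec d" "P *\<^sub>v u = u" for u
    using cscalar_prod_mat_adjoint[OF PC u(1) w] u PA Pw w by simp
  define E where "E = (1 / c) \<cdot>\<^sub>m ket_bra w"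
  have E: "E \<in> carrier_mat d d" using w by (simp add: E_def)
  have EA: "mat_adjoint E = E" by (simp add: E_def mat_adjoint_smult cr)
  have PE: "P * E = 0\<^sub>m d d"
    unfolding E_def using w PC Pw
    by (subst mult_smult_distrib[of _ d d _ d]) (auto simp: mult_ket_bra[of _ d d] intro!: eq_matI)
  have EP: "E * P = 0\<^sub>m d d"
  proof -
    have "E * P = mat_adjoint (P * E)" using PC E PA EA by (simp add: mat_adjoint_mult)
    also have "\<dots> = 0\<^sub>m d d" unfolding PE by (intro eq_matI) (auto simp: mat_adjoint_index)
    finally show ?thesis .
  qed
  have EE: "E * E = E"
    unfolding E_def using w c0
    by (simp add: smult_ket_bra_square[of _ d] c_def[symmetric]) (intro eq_matI, auto)
  define Q where "Q = P + E"
  have QC: "Q \<in> carrier_mat d d" using PC E by (simp add: Q_def)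
  have Qu: "Q *\<^sub>v u = P *\<^sub>v u + ((u \<bullet>c w) / c) \<cdot>\<^sub>v w" if u: "u \<in> carrier_vec d" for u
  proof -
    have "E *\<^sub>v u = ((u \<bullet>c w) / c) \<cdot>\<^sub>v w"
      using smult_ket_bra_mult_vec[OF w u, of "1 / c"] unfolding E_def by simp
    thus ?thesis unfolding Q_def using PC E u by (simp add: add_mult_distrib_mat_vec)
  qed
  have "Q * Q = P * P + E * P + (P * E + E * E)"
    unfolding Q_def using PC E
    by (simp add: add_mult_distrib_mat[of _ d d] mult_add_distrib_mat[of _ d d])
  hence QQ: "Q * Q = Q" using PC E by (simp add: PP PE EP EE Q_def)
  have Qproj: "projector d Q"
    using QC QQ PC E by (simp add: projector_def Q_def mat_adjoint_add[of _ d d] PA EA)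
  \<comment> \<open>This makes the coefficient of \<open>w\<close> in \<open>Q *\<^sub>v v\<close>
    equal to 1, so that the two orthogonal components add up to \<open>v\<close> again.\<close>
  have "v \<bullet>c w = c"
  proof -
    have "v = P *\<^sub>v v + w" using v PC unfolding w_def by auto
    hence "v \<bullet>c w = (P *\<^sub>v v) \<bullet>c w + w \<bullet>c w"
      using v w PC by (metis add_scalar_prod_distrib carrier_vec_conjugate mult_mat_vec_carrier)
    also have "(P *\<^sub>v v) \<bullet>c w = 0" using v PC PPv by (intro orth) auto
    finally show ?thesis by (simp add: c_def)
  qed
  hence Qv: "Q *\<^sub>v v = v"
    using Qu[OF v] c0 v PC unfolding w_def by (intro eq_vecI) auto
  have Tr: "mat_trace Q = mat_trace P + 1"
    unfolding Q_def E_def using PC w c0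
    by (simp add: mat_trace_add[of _ d] mat_trace_smult[of _ d] mat_trace_ket_bra[of _ d] c_def[symmetric])
  show ?thesis
  proof (rule that[OF Qproj Qv])
    fix u assume u: "u \<in> carrier_vec d" "P *\<^sub>v u = u"
    show "Q *\<^sub>v u = u" using Qu[OF u(1)] orth[OF u] u w by (auto)
  qed (use Tr in simp)
qed

lemma projector_onto_span:
  assumes "finite S" "S \<subseteq> carrier_vec d"
  shows "\<exists>P. projector d P \<and> (\<forall>v\<in>S. P *\<^sub>v v = v) \<and> frob P \<le> card S"
proof -
  \<comment> \<open>The induction records the complex trace as a natural number \<open>k\<close>;
    for a projector \<open>P * mat_adjoint P = P\<close>, so \<open>k\<close> is also the value of
    \<open>frob P\<close>.\<close>
  have "\<exists>P k. projector d P \<and> (\<forall>v\<in>S. P *\<^sub>v v = v) \<and> mat_trace P = of_nat k \<and> k \<le> card S"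
    using assms
  proof (induction S rule: finite_induct)
    case empty
    have "projector d (0\<^sub>m d d)"
      by (auto simp: projector_def mat_adjoint_index intro!: eq_matI)
    moreover have "mat_trace (0\<^sub>m d d) = of_nat 0" by (simp add: mat_trace_def)
    ultimately show ?case by fastforce
  next
    case (insert v S)
    then obtain P k where P: "projector d P" "\<forall>v\<in>S. P *\<^sub>v v = v" "mat_trace P = of_nat k" "k \<le> card S"
      by auto
    obtain Q where Q: "projector d Q" "Q *\<^sub>v v = v"
      "\<And>u. u \<in> carrier_vec d \<Longrightarrow> P *\<^sub>v u = u \<Longrightarrow> Q *\<^sub>v u = u"
      "mat_trace Q = mat_trace P \<or> mat_trace Q = mat_trace P + 1"
      using projector_extend[OF P(1), of v] insert.prems by auto
    from Q(4) P(3) have "mat_trace Q = of_nat k \<or> mat_trace Q = of_nat (Suc k)" by auto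
    then obtain k' where "mat_trace Q = of_nat k'" "k' \<le> Suc k" by (metis lessI order.refl less_imp_le)
    moreover have "\<forall>u\<in>insert v S. Q *\<^sub>v u = u" using Q P insert.prems by auto
    ultimately show ?case using Q(1) P(4) insert.hyps by (intro exI[of _ Q] exI[of _ k']) auto
  qed
  then obtain P k where P: "projector d P" "\<forall>v\<in>S. P *\<^sub>v v = v" "mat_trace P = of_nat k" "k \<le> card S"
    by blast
  have "complex_of_real (frob P) = complex_of_real (real k)"
    using P(1,3) by (simp add: frob_eq_trace projector_def)
  hence "frob P = k" using of_real_eq_iff by blast
  thus ?thesis using P by auto
qed

section \<open>Unitaries and their transitivity on pure states\<close>

lemma cscalar_prod_unitary:
  assumes U: "unitary_mat d U" and v: "v \<in> carrier_vec d" and w: "w \<in> carrier_vec d"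
  shows "(U *\<^sub>v v) \<bullet>c (U *\<^sub>v w) = v \<bullet>c w"
proof -
  have UC: "U \<in> carrier_mat d d" and UU: "mat_adjoint U * U = 1\<^sub>m d"
    using U by (auto simp: unitary_mat_def)
  have "(U *\<^sub>v v) \<bullet>c (U *\<^sub>v w) = v \<bullet>c (mat_adjoint U *\<^sub>v (U *\<^sub>v w))"
    using UC v w by (intro cscalar_prod_mat_adjoint[of _ d d]) auto
  also have "mat_adjoint U *\<^sub>v (U *\<^sub>v w) = w"
    using UC UU w by (metis assoc_mult_mat_vec mat_adjoint_carrier one_mult_mat_vec)
  finally show ?thesis .
qed

text \<open>A Householder reflection does this. Reaching \<open>v\<close> up to a phase suffices,
  since the moments below only see moduli of inner products.\<close>

lemma exists_unitary_mapping:
  assumes u: "u \<in> pure_states m" and v: "v \<in> pure_states m"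
  obtains U c where "unitary_mat (2 ^ m) U" "cmod c = 1" "U *\<^sub>v u = c \<cdot>\<^sub>v v"
proof -
  define d :: nat where "d = 2 ^ m"
  have uC: "u \<in> carrier_vec d" and vC: "v \<in> carrier_vec d" and uu: "u \<bullet>c u = 1" and vv: "v \<bullet>c v = 1"
    using u v by (auto simp: pure_states_def d_def)
  \<comment> \<open>The phase \<open>c\<close> makes \<open>u \<bullet>c (c v)\<close> real, so that reflecting in \<open>u - c v\<close> swaps \<open>u\<close> and \<open>c v\<close>.\<close>
  define z where "z = u \<bullet>c v"
  define c where "c = (if z = 0 then 1 else z / of_real (cmod z))"
  have c1: "cmod c = 1" by (simp add: c_def norm_divide)
  have ccnj: "c * cnj c = 1" using c1 by (metis complex_norm_square of_real_1 power_one)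
  have zc: "cnj c * z = of_real (cmod z)"
    by (auto simp: c_def field_simps complex_norm_square[symmetric] power2_eq_square)
  define y where "y = c \<cdot>\<^sub>v v"
  have yC: "y \<in> carrier_vec d" using vC by (simp add: y_def)
  have uy: "u \<bullet>c y = of_real (cmod z)"
    using uC vC zc by (simp add: y_def conjugate_smult_vec z_def)
  have yu: "y \<bullet>c u = of_real (cmod z)"
    using cnj_cscalar_prod[OF uC yC] uy by simp
  have yy: "y \<bullet>c y = 1"
    using vC vv ccnj by (simp add: y_def conjugate_smult_vec mult.commute)
  define w where "w = u - y"
  have wC: "w \<in> carrier_vec d" using uC yC by (simp add: w_def)
  define q where "q = w \<bullet>c w"
  have uw: "u \<bullet>c w = 1 - of_real (cmod z)"
    using uC yC wC uu uy
    by (simp add: cscalar_prod_eq_sum[of _ d] w_def algebra_simps sum_subtractf)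
  have yw: "y \<bullet>c w = of_real (cmod z) - 1"
    using uC yC wC yy yu
    by (simp add: cscalar_prod_eq_sum[of _ d] w_def algebra_simps sum_subtractf)
  \<comment> \<open>Both \<open>u\<close> and \<open>y\<close> are unit vectors with a real inner
    product. The identity makes \<open>2 / q * (u \<bullet>c w)\<close> equal to 1, so that
    \<open>E\<close> maps \<open>u\<close> to \<open>w\<close> and \<open>1 - E\<close> maps it to
    \<open>y\<close>.\<close>
  have q: "q = 2 * (u \<bullet>c w)"
  proof -
    have "q = u \<bullet>c w - y \<bullet>c w" unfolding q_def
      using uC yC wC by (simp add: cscalar_prod_eq_sum[of _ d] w_def algebra_simps sum_subtractf sum.distrib)
    thus ?thesis using uw yw by simp
  qed
  show ?thesis
  proof (cases "q = 0")
    case True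
    hence "w = 0\<^sub>v d" using wC unfolding q_def by simp
    hence "u = y" using uC yC unfolding w_def
      by (intro eq_vecI) (auto simp: vec_eq_iff)
    hence "1\<^sub>m d *\<^sub>v u = c \<cdot>\<^sub>v v" using uC by (simp add: y_def)
    moreover have "unitary_mat d (1\<^sub>m d)" by (simp add: unitary_mat_def)
    ultimately show ?thesis using that c1 d_def by blast
  next
    case False
    have qr: "cnj q = q" unfolding q_def by (rule cnj_cscalar_prod[OF wC wC])
    define E where "E = (2 / q) \<cdot>\<^sub>m ket_bra w"
    have E: "E \<in> carrier_mat d d" using wC by (simp add: E_def)
    have EA: "mat_adjoint E = E" by (simp add: E_def mat_adjoint_smult qr)
    have EE: "E * E = 2 \<cdot>\<^sub>m E"
      unfolding E_def using wC False
      by (simp add: smult_ket_bra_square[of _ d] q_def[symmetric])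
    define U where "U = 1\<^sub>m d - E"
    have "U * U = 1\<^sub>m d - E - (E - E * E)"
      unfolding U_def by (rule one_minus_square[OF E])
    also have "\<dots> = 1\<^sub>m d" unfolding EE using E by (intro eq_matI) auto
    finally have "unitary_mat d U"
      using minus_carrier_mat[OF E] EA mat_adjoint_minus[OF one_carrier_mat E]
      by (simp add: unitary_mat_def U_def)
    moreover have "U *\<^sub>v u = c \<cdot>\<^sub>v v"
    proof -
      have "E *\<^sub>v u = (2 / q * (u \<bullet>c w)) \<cdot>\<^sub>v w"
        unfolding E_def by (rule smult_ket_bra_mult_vec[OF wC uC])
      also have "2 / q * (u \<bullet>c w) = 1" using False q by simp
      finally have "E *\<^sub>v u = w" by simp
      hence "U *\<^sub>v u = u - w"
        unfolding U_def using minus_mult_distrib_mat_vec[OF one_carrier_mat E uC] uC by simp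
      also have "\<dots> = y" unfolding w_def using uC yC by (intro eq_vecI) auto
      finally show ?thesis by (simp add: y_def)
    qed
    ultimately show ?thesis using that c1 d_def by blast
  qed
qed


section \<open>Tensor powers of vectors\<close>

text \<open>The index convention is that of \<open>kron\<close>, with the left factor most
  significant, so that rank-one operators multiply without reindexing.\<close>

definition vec_kron :: "complex vec \<Rightarrow> complex vec \<Rightarrow> complex vec" where
  "vec_kron v w = vec (dim_vec v * dim_vec w) (\<lambda>i. v $ (i div dim_vec w) * w $ (i mod dim_vec w))"

primrec vec_pow :: "complex vec \<Rightarrow> nat \<Rightarrow> complex vec" where
  "vec_pow v 0 = vec 1 (\<lambda>_. 1)"
| "vec_pow v (Suc t) = vec_kron v (vec_pow v t)"

lemma dim_vec_kron [simp]: "dim_vec (vec_kron v w) = dim_vec v * dim_vec w"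
  by (simp add: vec_kron_def)

lemma dim_vec_pow [simp]: "dim_vec (vec_pow v t) = dim_vec v ^ t"
  by (induction t) simp_all

lemma vec_pow_carrier: "v \<in> carrier_vec d \<Longrightarrow> vec_pow v t \<in> carrier_vec (d ^ t)"
  by (metis carrier_vecD carrier_vec_dim_vec dim_vec_pow)

lemma div_mod_less_mult:
  fixes i a b :: nat
  assumes "i < a * b"
  shows "i div b < a" "i mod b < b"
proof -
  show "i div b < a" using assms by (simp add: less_mult_imp_div_less)
  have "0 < b" using assms by (cases b) auto
  thus "i mod b < b" by simp
qed

lemma cscalar_prod_vec_kron:
  assumes v: "v \<in> carrier_vec a" "v' \<in> carrier_vec a" and w: "w \<in> carrier_vec b" "w' \<in> carrier_vec b"
  shows "vec_kron v w \<bullet>c vec_kron v' w' = (v \<bullet>c v') * (w \<bullet>c w')"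
proof -
  have C: "vec_kron v w \<in> carrier_vec (a * b)" "vec_kron v' w' \<in> carrier_vec (a * b)"
    using v w by (metis carrier_vecD carrier_vec_dim_vec dim_vec_kron)+
  have "vec_kron v w \<bullet>c vec_kron v' w' =
      (\<Sum>i<a*b. (v $ (i div b) * w $ (i mod b)) * cnj (v' $ (i div b) * w' $ (i mod b)))"
    unfolding cscalar_prod_eq_sum[OF C] using v w by (intro sum.cong) (auto simp: vec_kron_def)
  also have "\<dots> = (\<Sum>i<a. \<Sum>j<b. (v $ i * w $ j) * cnj (v' $ i * w' $ j))"
    unfolding sum_mult_product by (intro sum.cong) auto
  also have "\<dots> = (v \<bullet>c v') * (w \<bullet>c w')"
    unfolding cscalar_prod_eq_sum[OF v] cscalar_prod_eq_sum[OF w] sum_product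
    by (intro sum.cong) (auto simp: mult_ac)
  finally show ?thesis .
qed

lemma cscalar_prod_vec_pow:
  assumes v: "v \<in> carrier_vec d" "v' \<in> carrier_vec d"
  shows "vec_pow v t \<bullet>c vec_pow v' t = (v \<bullet>c v') ^ t"
proof (induction t)
  case 0
  show ?case by (simp add: scalar_prod_def)
next
  case (Suc t)
  thus ?case using cscalar_prod_vec_kron[OF v vec_pow_carrier[OF v(1)] vec_pow_carrier[OF v(2)]]
    by simp
qed

lemma kron_ket_bra: "kron (ket_bra v) (ket_bra w) = ket_bra (vec_kron v w)"
  by (intro eq_matI) (auto simp: kron_def vec_kron_def div_mod_less_mult)

lemma tensor_pow_ket_bra: "tensor_pow (ket_bra v) t = ket_bra (vec_pow v t)"
proof (induction t)
  case 0
  show ?case by (intro eq_matI) auto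
next
  case (Suc t)
  thus ?case by (simp add: kron_ket_bra)
qed

lemma outcome_prob_tensor_pow:
  assumes "A \<in> carrier_mat (d ^ t) (d ^ t)" "v \<in> carrier_vec d"
  shows "outcome_prob A (tensor_pow (ket_bra v) t) = Re ((A *\<^sub>v vec_pow v t) \<bullet>c vec_pow v t)"
  unfolding outcome_prob_def tensor_pow_ket_bra
  using mat_trace_mult_ket_bra[OF assms(1) vec_pow_carrier[OF assms(2)]] by simp

lemma cmod_index_pure_state_le:
  assumes v: "v \<in> pure_states m" and i: "i < 2 ^ m"
  shows "cmod (v $ i) \<le> 1"
proof -
  have vC: "v \<in> carrier_vec (2 ^ m)" and vv: "v \<bullet>c v = 1" using v by (auto simp: pure_states_def)
  have "complex_of_real (\<Sum>j<2 ^ m. (cmod (v $ j))\<^sup>2) = v \<bullet>c v"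
    unfolding cscalar_prod_eq_sum[OF vC vC]
    by (simp add: complex_norm_square del: of_real_power)
  hence "(\<Sum>j<2 ^ m. (cmod (v $ j))\<^sup>2) = 1" using vv of_real_eq_1_iff by metis
  moreover have "(cmod (v $ i))\<^sup>2 \<le> (\<Sum>j<2 ^ m. (cmod (v $ j))\<^sup>2)"
    using i by (intro member_le_sum[where f = "\<lambda>j. (cmod (v $ j))\<^sup>2"]) simp_all
  ultimately show ?thesis by (metis norm_ge_zero one_power2 power2_le_imp_le zero_le_one)
qed

lemma vec_pow_Suc_index:
  assumes "v \<in> carrier_vec d" "i < d ^ Suc t"
  shows "vec_pow v (Suc t) $ i = v $ (i div d ^ t) * vec_pow v t $ (i mod d ^ t)"
  using assms by (auto simp: vec_kron_def)

text \<open>A uniform bound on the entries: together with measurability it makes all their products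
  integrable over a probability measure.\<close>

lemma cmod_index_vec_pow_le:
  assumes v: "v \<in> pure_states m" and i: "i < (2 ^ m) ^ t"
  shows "cmod (vec_pow v t $ i) \<le> 1"
  using i
proof (induction t arbitrary: i)
  case 0
  thus ?case by simp
next
  case (Suc t)
  have vC: "v \<in> carrier_vec (2 ^ m)" using v by (simp add: pure_states_def)
  note b = div_mod_less_mult[of i "2 ^ m" "(2 ^ m) ^ t"]
  show ?case
    unfolding vec_pow_Suc_index[OF vC Suc.prems] norm_mult
    using Suc.prems cmod_index_pure_state_le[OF v b(1)] Suc.IH[OF b(2)]
    by (intro mult_le_one) auto
qed


section \<open>Moments of the Haar measure\<close>

locale haar_states =
  fixes m :: nat and H :: "complex vec measure"
  assumes haar: "haar_measure m H"
begin

sublocale prob_space H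
  using haar by (simp add: haar_measure_def)

section \<open>Measurability on the unit sphere\<close>

lemma generator_subset:
  "{{v \<in> pure_states m. v $ i \<in> B} | i B. i < 2 ^ m \<and> B \<in> sets borel} \<subseteq> Pow (pure_states m)"
  by auto

lemma sets_H: "sets H = sets (pure_state_algebra m)"
  using haar by (simp add: haar_measure_def)

lemma space_H: "space H = pure_states m"
  using sets_eq_imp_space_eq[OF sets_H] generator_subset
  by (simp add: pure_state_algebra_def space_measure_of)

lemma coordinate_measurable:
  assumes "i < 2 ^ m"
  shows "(\<lambda>v. v $ i) \<in> borel_measurable H"
proof (rule measurableI)
  fix B :: "complex set" assume B: "B \<in> sets borel"
  have "{v \<in> pure_states m. v $ i \<in> B} \<in> sets (pure_state_algebra m)"
    unfolding pure_state_algebra_def sets_measure_of[OF generator_subset]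
    using assms B by (intro sigma_sets.Basic) blast
  moreover have "(\<lambda>v. v $ i) -` B \<inter> space H = {v \<in> pure_states m. v $ i \<in> B}"
    by (auto simp: space_H)
  ultimately show "(\<lambda>v. v $ i) -` B \<inter> space H \<in> sets H" by (simp add: sets_H)
qed simp

text \<open>It is enough to treat the generators, and each coordinate of
  \<open>U *\<^sub>v v\<close> is a linear combination of the coordinates of \<open>v\<close>. The
  change of variables along \<open>U\<close> rests on this.\<close>

lemma unitary_measurable:
  assumes U: "unitary_mat (2 ^ m) U"
  shows "(\<lambda>v. U *\<^sub>v v) \<in> measurable H H"
proof -
  have UC: "U \<in> carrier_mat (2 ^ m) (2 ^ m)" using U by (simp add: unitary_mat_def)
  have "(\<lambda>v. U *\<^sub>v v) \<in> measurable H (pure_state_algebra m)"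
    unfolding pure_state_algebra_def
  proof (rule measurable_measure_of[OF generator_subset])
    show "(\<lambda>v. U *\<^sub>v v) \<in> space H \<rightarrow> pure_states m"
      using UC cscalar_prod_unitary[OF U] by (auto simp: space_H pure_states_def)
    fix Y assume "Y \<in> {{v \<in> pure_states m. v $ i \<in> B} | i B. i < 2 ^ m \<and> B \<in> sets borel}"
    then obtain i B where Y: "Y = {v \<in> pure_states m. v $ i \<in> B}" and i: "i < 2 ^ m"
      and B: "B \<in> sets borel" by blast
    have "(\<lambda>v. \<Sum>j<2 ^ m. U $$ (i, j) * v $ j) \<in> borel_measurable H"
      by (intro borel_measurable_sum borel_measurable_times coordinate_measurable) auto
    hence "(\<lambda>v. \<Sum>j<2 ^ m. U $$ (i, j) * v $ j) -` B \<inter> space H \<in> sets H"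
      using B by (rule measurable_sets)
    moreover have "(\<lambda>v. \<Sum>j<2 ^ m. U $$ (i, j) * v $ j) -` B \<inter> space H = (\<lambda>v. U *\<^sub>v v) -` Y \<inter> space H"
    proof -
      have "(U *\<^sub>v v) $ i = (\<Sum>j<2 ^ m. U $$ (i, j) * v $ j)" "U *\<^sub>v v \<in> pure_states m"
        if "v \<in> pure_states m" for v
        using UC i that cscalar_prod_unitary[OF U]
        by (auto simp: pure_states_def scalar_prod_def atLeast0LessThan intro!: sum.cong)
      thus ?thesis by (auto simp: Y space_H)
    qed
    ultimately show "(\<lambda>v. U *\<^sub>v v) -` Y \<inter> space H \<in> sets H" by simp
  qed
  thus ?thesis by (subst measurable_cong_sets[OF refl sets_H])
qed

lemma cscalar_prod_measurable:
  assumes v: "v \<in> carrier_vec (2 ^ m)"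
  shows "(\<lambda>\<theta>. \<theta> \<bullet>c v) \<in> borel_measurable H"
proof -
  have "(\<lambda>\<theta>. \<theta> \<bullet>c v) \<in> borel_measurable H \<longleftrightarrow>
      (\<lambda>\<theta>. \<Sum>i<2 ^ m. \<theta> $ i * cnj (v $ i)) \<in> borel_measurable H"
    using v by (intro measurable_cong) (auto simp: space_H pure_states_def intro!: cscalar_prod_eq_sum)
  moreover have "(\<lambda>\<theta>. \<Sum>i<2 ^ m. \<theta> $ i * cnj (v $ i)) \<in> borel_measurable H"
    by (intro borel_measurable_sum borel_measurable_times coordinate_measurable) auto
  ultimately show ?thesis by simp
qed

section \<open>Overlap moments and their invariance\<close>

definition overlap_moment :: "nat \<Rightarrow> complex vec \<Rightarrow> real" where
  "overlap_moment t v = (\<integral>\<theta>. cmod (\<theta> \<bullet>c v) ^ (2 * t) \<partial>H)"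

lemma overlap_integrable:
  assumes v: "v \<in> pure_states m"
  shows "integrable H (\<lambda>\<theta>. cmod (\<theta> \<bullet>c v) ^ k)"
\<comment> \<open>A crude bound, one unit for each coordinate, is enough for integrability.\<close>
proof (rule integrable_const_bound[where B = "real (2 ^ m) ^ k"])
  have vC: "v \<in> carrier_vec (2 ^ m)" using v by (simp add: pure_states_def)
  show "(\<lambda>\<theta>. cmod (\<theta> \<bullet>c v) ^ k) \<in> borel_measurable H"
    using cscalar_prod_measurable[OF vC] by measurable
  have "cmod (\<theta> \<bullet>c v) \<le> real (2 ^ m)" if \<theta>: "\<theta> \<in> pure_states m" for \<theta>
  proof -
    have \<theta>C: "\<theta> \<in> carrier_vec (2 ^ m)" using \<theta> by (simp add: pure_states_def)
    have "cmod (\<theta> \<bullet>c v) \<le> (\<Sum>i<2 ^ m. cmod (\<theta> $ i * cnj (v $ i)))"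
      unfolding cscalar_prod_eq_sum[OF \<theta>C vC] by (rule norm_sum)
    also have "\<dots> \<le> (\<Sum>i<(2::nat) ^ m. 1)"
      using \<theta> v by (intro sum_mono) (auto simp: norm_mult intro!: mult_le_one cmod_index_pure_state_le)
    finally show ?thesis by simp
  qed
  thus "AE \<theta> in H. norm (cmod (\<theta> \<bullet>c v) ^ k) \<le> real (2 ^ m) ^ k"
    by (intro AE_I2) (auto simp: space_H intro!: power_mono)
qed

text \<open>For a unitary \<open>U\<close> taking \<open>u\<close> to
  \<open>c \<cdot>\<^sub>v v\<close>, the overlap of \<theta> with \<open>u\<close> is that of
  \<open>U *\<^sub>v \<theta>\<close> with \<open>v\<close> up to a phase, and
  \<open>U *\<^sub>v \<theta>\<close> is distributed like \<theta>.\<close>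

lemma overlap_moment_eq:
  assumes u: "u \<in> pure_states m" and v: "v \<in> pure_states m"
  shows "overlap_moment t u = overlap_moment t v"
proof -
  obtain U c where U: "unitary_mat (2 ^ m) U" and c: "cmod c = 1" and Uu: "U *\<^sub>v u = c \<cdot>\<^sub>v v"
    using exists_unitary_mapping[OF u v] by blast
  have uC: "u \<in> carrier_vec (2 ^ m)" and vC: "v \<in> carrier_vec (2 ^ m)"
    using u v by (auto simp: pure_states_def)
  have UC: "U \<in> carrier_mat (2 ^ m) (2 ^ m)" using U by (simp add: unitary_mat_def)
  have "overlap_moment t u = (\<integral>\<theta>. cmod ((U *\<^sub>v \<theta>) \<bullet>c v) ^ (2 * t) \<partial>H)"
    unfolding overlap_moment_def
  proof (rule Bochner_Integration.integral_cong[OF refl])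
    fix \<theta> assume "\<theta> \<in> space H"
    hence \<theta>: "\<theta> \<in> carrier_vec (2 ^ m)" by (simp add: space_H pure_states_def)
    have "\<theta> \<bullet>c u = (U *\<^sub>v \<theta>) \<bullet>c (c \<cdot>\<^sub>v v)"
      using cscalar_prod_unitary[OF U \<theta> uC] Uu by simp
    also have "\<dots> = cnj c * ((U *\<^sub>v \<theta>) \<bullet>c v)"
      using UC vC \<theta> by (simp add: conjugate_smult_vec)
    finally show "cmod (\<theta> \<bullet>c u) ^ (2 * t) = cmod ((U *\<^sub>v \<theta>) \<bullet>c v) ^ (2 * t)"
      by (simp add: norm_mult c)
  qed
  also have "\<dots> = (\<integral>\<theta>. cmod (\<theta> \<bullet>c v) ^ (2 * t) \<partial>distr H H (\<lambda>\<theta>. U *\<^sub>v \<theta>))"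
    by (rule integral_distr[symmetric, OF unitary_measurable[OF U]])
      (use cscalar_prod_measurable[OF vC] in measurable)
  also have "distr H H (\<lambda>\<theta>. U *\<^sub>v \<theta>) = H"
    using haar U by (simp add: haar_measure_def)
  finally show ?thesis by (simp add: overlap_moment_def)
qed

lemma vec_pow_measurable:
  "i < (2 ^ m) ^ t \<Longrightarrow> (\<lambda>\<theta>. vec_pow \<theta> t $ i) \<in> borel_measurable H"
proof (induction t arbitrary: i)
  case 0
  thus ?case by simp
next
  case (Suc t)
  note b = div_mod_less_mult[of i "2 ^ m" "(2 ^ m) ^ t"]
  have "(\<lambda>\<theta>. vec_pow \<theta> (Suc t) $ i) \<in> borel_measurable H \<longleftrightarrow>
    (\<lambda>\<theta>. \<theta> $ (i div (2 ^ m) ^ t) * vec_pow \<theta> t $ (i mod (2 ^ m) ^ t)) \<in> borel_measurable H"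
    using Suc.prems by (intro measurable_cong vec_pow_Suc_index) (auto simp: space_H pure_states_def)
  moreover have "(\<lambda>\<theta>. \<theta> $ (i div (2 ^ m) ^ t) * vec_pow \<theta> t $ (i mod (2 ^ m) ^ t)) \<in> borel_measurable H"
    using Suc.prems b by (intro borel_measurable_times coordinate_measurable Suc.IH) auto
  ultimately show ?case by simp
qed

section \<open>The moment operator and its Hilbert-Schmidt norm\<close>

text \<open>The indices are transposed: this is entry \<open>(j, i)\<close> of the moment operator
  \<open>M\<close>, so that the trace of \<open>B * M\<close> is the entrywise sum of
  \<open>B $$ (i, j) * tensor_moment t i j\<close>.\<close>

definition tensor_moment :: "nat \<Rightarrow> nat \<Rightarrow> nat \<Rightarrow> complex" where
  "tensor_moment t i j = (\<integral>\<theta>. vec_pow \<theta> t $ j * cnj (vec_pow \<theta> t $ i) \<partial>H)"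

lemma tensor_moment_integrable:
  assumes "i < (2 ^ m) ^ t" "j < (2 ^ m) ^ t"
  shows "integrable H (\<lambda>\<theta>. vec_pow \<theta> t $ j * cnj (vec_pow \<theta> t $ i))"
proof (rule integrable_const_bound[where B = 1])
  show "(\<lambda>\<theta>. vec_pow \<theta> t $ j * cnj (vec_pow \<theta> t $ i)) \<in> borel_measurable H"
    by (intro borel_measurable_times vec_pow_measurable assms
        measurable_compose[OF vec_pow_measurable[OF assms(1)] borel_measurable_continuous_onI]
        continuous_intros)
  show "AE \<theta> in H. norm (vec_pow \<theta> t $ j * cnj (vec_pow \<theta> t $ i)) \<le> 1"
    using assms by (intro AE_I2) (auto simp: norm_mult space_H intro!: mult_le_one cmod_index_vec_pow_le)
qed

lemma integral_sum_tensor_moment: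
  fixes c :: "nat \<Rightarrow> nat \<Rightarrow> complex"
  assumes "D = (2 ^ m) ^ t"
  shows "(\<integral>\<theta>. (\<Sum>i<D. \<Sum>j<D. c i j * (vec_pow \<theta> t $ j * cnj (vec_pow \<theta> t $ i))) \<partial>H) =
    (\<Sum>i<D. \<Sum>j<D. c i j * tensor_moment t i j)"
proof -
  have I: "integrable H (\<lambda>\<theta>. c i j * (vec_pow \<theta> t $ j * cnj (vec_pow \<theta> t $ i)))"
    if "i < D" "j < D" for i j
    using that tensor_moment_integrable[of i t j] assms by (intro integrable_mult_right) auto
  have "(\<integral>\<theta>. (\<Sum>i<D. \<Sum>j<D. c i j * (vec_pow \<theta> t $ j * cnj (vec_pow \<theta> t $ i))) \<partial>H) =
    (\<Sum>i<D. (\<integral>\<theta>. (\<Sum>j<D. c i j * (vec_pow \<theta> t $ j * cnj (vec_pow \<theta> t $ i))) \<partial>H))"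
    using I by (intro Bochner_Integration.integral_sum Bochner_Integration.integrable_sum) auto
  also have "\<dots> = (\<Sum>i<D. \<Sum>j<D. (\<integral>\<theta>. c i j * (vec_pow \<theta> t $ j * cnj (vec_pow \<theta> t $ i)) \<partial>H))"
    using I by (intro sum.cong refl Bochner_Integration.integral_sum) auto
  finally show ?thesis by (simp add: tensor_moment_def)
qed

text \<open>The left side is the trace of \<open>M * M\<close> for the Hermitian moment operator
  \<open>M\<close>. Expanding one factor over \<theta>' and the other over \<theta> gives the double
  average of \<open>cmod (\<theta> \<bullet>c \<theta>') ^ (2 * t)\<close>, whose inner average is
  the same for every \<theta>'.\<close>

lemma tensor_moment_frob:
  assumes v: "v \<in> pure_states m" and D: "D = (2 ^ m) ^ t"
  shows "(\<Sum>i<D. \<Sum>j<D. (cmod (tensor_moment t i j))\<^sup>2) = overlap_moment t v"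
proof -
  let ?w = "\<lambda>\<theta>. vec_pow \<theta> t"
  have cnj_moment: "cnj (tensor_moment t i j) = tensor_moment t j i" for i j
    unfolding tensor_moment_def
    by (simp add: mult.commute flip: Bochner_Integration.integral_cnj)
  \<comment> \<open>The inner average, at a fixed \<theta>'. Both expansions use linearity of the
    integral over finite sums.\<close>
  have inner: "(\<Sum>i<D. \<Sum>j<D. tensor_moment t j i * (?w \<theta>' $ j * cnj (?w \<theta>' $ i))) =
      of_real (overlap_moment t v)" if \<theta>': "\<theta>' \<in> pure_states m" for \<theta>'
  proof -
    have \<theta>'C: "\<theta>' \<in> carrier_vec (2 ^ m)" using \<theta>' by (simp add: pure_states_def)
    have w': "?w \<theta>' \<in> carrier_vec D" using vec_pow_carrier[OF \<theta>'C] D by simp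
    have "(\<Sum>i<D. \<Sum>j<D. tensor_moment t j i * (?w \<theta>' $ j * cnj (?w \<theta>' $ i))) =
      (\<Sum>i<D. \<Sum>j<D. (?w \<theta>' $ i * cnj (?w \<theta>' $ j)) * tensor_moment t i j)"
      by (subst sum.swap) (simp add: mult_ac)
    also have "\<dots> = (\<integral>\<theta>. (\<Sum>i<D. \<Sum>j<D. (?w \<theta>' $ i * cnj (?w \<theta>' $ j)) *
        (?w \<theta> $ j * cnj (?w \<theta> $ i))) \<partial>H)"
      by (rule integral_sum_tensor_moment[OF D, symmetric])
    also have "\<dots> = (\<integral>\<theta>. of_real (cmod (\<theta> \<bullet>c \<theta>') ^ (2 * t)) \<partial>H)"
    proof (rule Bochner_Integration.integral_cong[OF refl])
      fix \<theta> assume "\<theta> \<in> space H"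
      hence \<theta>: "\<theta> \<in> carrier_vec (2 ^ m)" by (simp add: space_H pure_states_def)
      have w: "?w \<theta> \<in> carrier_vec D" using vec_pow_carrier[OF \<theta>] D by simp
      have "(\<Sum>i<D. \<Sum>j<D. (?w \<theta>' $ i * cnj (?w \<theta>' $ j)) * (?w \<theta> $ j * cnj (?w \<theta> $ i))) =
        (?w \<theta>' \<bullet>c ?w \<theta>) * (?w \<theta> \<bullet>c ?w \<theta>')"
        unfolding cscalar_prod_eq_sum[OF w w'] cscalar_prod_eq_sum[OF w' w] sum_product
        by (simp add: mult_ac)
      also have "?w \<theta>' \<bullet>c ?w \<theta> = cnj (?w \<theta> \<bullet>c ?w \<theta>')"
        by (rule cnj_cscalar_prod[OF w w', symmetric])
      also have "\<dots> * (?w \<theta> \<bullet>c ?w \<theta>') = of_real ((cmod (?w \<theta> \<bullet>c ?w \<theta>'))\<^sup>2)"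
        by (simp add: complex_norm_square mult.commute del: of_real_power)
      also have "?w \<theta> \<bullet>c ?w \<theta>' = (\<theta> \<bullet>c \<theta>') ^ t"
        by (rule cscalar_prod_vec_pow[OF \<theta> \<theta>'C])
      also have "(cmod ((\<theta> \<bullet>c \<theta>') ^ t))\<^sup>2 = cmod (\<theta> \<bullet>c \<theta>') ^ (2 * t)"
        by (simp add: norm_power power_mult[symmetric] mult.commute)
      finally show "(\<Sum>i<D. \<Sum>j<D. (?w \<theta>' $ i * cnj (?w \<theta>' $ j)) * (?w \<theta> $ j * cnj (?w \<theta> $ i))) =
        of_real (cmod (\<theta> \<bullet>c \<theta>') ^ (2 * t))" .
    qed
    also have "\<dots> = of_real (overlap_moment t \<theta>')"
      unfolding overlap_moment_def by (rule integral_of_real[OF overlap_integrable[OF \<theta>']])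
    also have "overlap_moment t \<theta>' = overlap_moment t v"
      by (rule overlap_moment_eq[OF \<theta>' v])
    finally show ?thesis .
  qed
  have "complex_of_real (\<Sum>i<D. \<Sum>j<D. (cmod (tensor_moment t i j))\<^sup>2) =
      (\<Sum>i<D. \<Sum>j<D. tensor_moment t j i * tensor_moment t i j)"
    by (simp add: complex_norm_square cnj_moment mult.commute del: of_real_power)
  also have "\<dots> = (\<integral>\<theta>'. (\<Sum>i<D. \<Sum>j<D. tensor_moment t j i * (?w \<theta>' $ j * cnj (?w \<theta>' $ i))) \<partial>H)"
    by (rule integral_sum_tensor_moment[OF D, symmetric])
  also have "\<dots> = (\<integral>\<theta>'. of_real (overlap_moment t v) \<partial>H)"
    using inner by (intro Bochner_Integration.integral_cong) (auto simp: space_H)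
  also have "\<dots> = of_real (overlap_moment t v)" by (simp add: prob_space)
  finally show ?thesis using of_real_eq_iff by blast
qed

text \<open>Cauchy-Schwarz for the Hilbert-Schmidt product of \<open>B\<close> with the moment
  operator. It is applied to the accepting projector and to a sum of packing states.\<close>

lemma expectation_le_frob:
  assumes v: "v \<in> pure_states m" and B: "B \<in> carrier_mat ((2 ^ m) ^ t) ((2 ^ m) ^ t)"
  shows "(cmod (\<integral>\<theta>. (B *\<^sub>v vec_pow \<theta> t) \<bullet>c vec_pow \<theta> t \<partial>H))\<^sup>2 \<le> frob B * overlap_moment t v"
proof -
  define D where D: "D = ((2::nat) ^ m) ^ t"
  have BC: "B \<in> carrier_mat D D" using B D by simp
  let ?I = "{..<D} \<times> {..<D}"
  let ?M = "tensor_moment t"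
  have "(\<integral>\<theta>. (B *\<^sub>v vec_pow \<theta> t) \<bullet>c vec_pow \<theta> t \<partial>H) =
    (\<integral>\<theta>. (\<Sum>i<D. \<Sum>j<D. B $$ (i, j) * (vec_pow \<theta> t $ j * cnj (vec_pow \<theta> t $ i))) \<partial>H)"
  proof (intro Bochner_Integration.integral_cong refl cscalar_prod_mult_eq_sum[OF BC])
    fix \<theta> assume "\<theta> \<in> space H"
    thus "vec_pow \<theta> t \<in> carrier_vec D" unfolding D
      by (intro vec_pow_carrier) (simp add: space_H pure_states_def)
  qed
  also have "\<dots> = (\<Sum>i<D. \<Sum>j<D. B $$ (i, j) * ?M i j)"
    by (rule integral_sum_tensor_moment[OF D])
  also have "\<dots> = (\<Sum>p\<in>?I. B $$ p * ?M (fst p) (snd p))"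
    by (simp add: sum.cartesian_product case_prod_unfold)
  also have "(cmod \<dots>)\<^sup>2 \<le> (\<Sum>p\<in>?I. cmod (B $$ p) * cmod (?M (fst p) (snd p)))\<^sup>2"
    by (intro power_mono) (auto intro!: order_trans[OF norm_sum] simp: norm_mult)
  also have "\<dots> \<le> (\<Sum>p\<in>?I. (cmod (B $$ p))\<^sup>2) * (\<Sum>p\<in>?I. (cmod (?M (fst p) (snd p)))\<^sup>2)"
    by (rule Cauchy_Schwarz_ineq_sum)
  also have "(\<Sum>p\<in>?I. (cmod (B $$ p))\<^sup>2) = frob B"
    using BC by (simp add: frob_def sum.cartesian_product case_prod_unfold)
  also have "(\<Sum>p\<in>?I. (cmod (?M (fst p) (snd p)))\<^sup>2) = overlap_moment t v"
    unfolding tensor_moment_frob[OF v D, symmetric]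
    by (simp add: sum.cartesian_product case_prod_unfold)
  finally show ?thesis .
qed

lemma quadratic_form_integrable:
  assumes B: "B \<in> carrier_mat ((2 ^ m) ^ t) ((2 ^ m) ^ t)"
  shows "integrable H (\<lambda>\<theta>. (B *\<^sub>v vec_pow \<theta> t) \<bullet>c vec_pow \<theta> t)"
proof -
  define D where D: "D = ((2::nat) ^ m) ^ t"
  have "integrable H (\<lambda>\<theta>. \<Sum>i<D. \<Sum>j<D. B $$ (i, j) * (vec_pow \<theta> t $ j * cnj (vec_pow \<theta> t $ i)))"
    unfolding D
    by (intro Bochner_Integration.integrable_sum integrable_mult_right tensor_moment_integrable) auto
  moreover have "(B *\<^sub>v vec_pow \<theta> t) \<bullet>c vec_pow \<theta> t =
      (\<Sum>i<D. \<Sum>j<D. B $$ (i, j) * (vec_pow \<theta> t $ j * cnj (vec_pow \<theta> t $ i)))"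
    if "\<theta> \<in> space H" for \<theta>
  proof (rule cscalar_prod_mult_eq_sum)
    show "vec_pow \<theta> t \<in> carrier_vec D"
      unfolding D using that by (intro vec_pow_carrier) (simp add: space_H pure_states_def)
  qed (use B D in simp)
  ultimately show ?thesis
    using Bochner_Integration.integrable_cong[OF refl, of H] by (metis (no_types, lifting))
qed

lemma expected_outcome_prob_le:
  assumes v: "v \<in> pure_states m" and B: "B \<in> carrier_mat ((2 ^ m) ^ t) ((2 ^ m) ^ t)"
  shows "(\<integral>\<theta>. outcome_prob B (tensor_pow (ket_bra \<theta>) t) \<partial>H)\<^sup>2 \<le> frob B * overlap_moment t v"
proof -
  let ?q = "\<lambda>\<theta>. (B *\<^sub>v vec_pow \<theta> t) \<bullet>c vec_pow \<theta> t"
  have "(\<integral>\<theta>. outcome_prob B (tensor_pow (ket_bra \<theta>) t) \<partial>H) = (\<integral>\<theta>. Re (?q \<theta>) \<partial>H)"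
    using B by (intro Bochner_Integration.integral_cong refl outcome_prob_tensor_pow)
      (auto simp: space_H pure_states_def)
  also have "\<dots> = Re (\<integral>\<theta>. ?q \<theta> \<partial>H)"
    by (rule integral_Re[OF quadratic_form_integrable[OF B]])
  also have "\<dots>\<^sup>2 \<le> (cmod (\<integral>\<theta>. ?q \<theta> \<partial>H))\<^sup>2"
    by (simp add: abs_Re_le_cmod abs_le_square_iff[symmetric])
  finally show ?thesis using expectation_le_frob[OF v B] by simp
qed

section \<open>The packing bound on the overlap moment\<close>

lemma overlap_moment_nonneg: "0 \<le> overlap_moment t v"
  unfolding overlap_moment_def by (intro Bochner_Integration.integral_nonneg) simp

text \<open>The inequality is turned on the moment itself: for a sum of tensor power states the
  moment enters quadratically on the left and linearly on the right, so cancelling one factor bounds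
  it.\<close>

lemma overlap_moment_le_packing:
  assumes v: "v \<in> pure_states m" and F: "finite F" "F \<noteq> {}"
    and u: "\<And>a. a \<in> F \<Longrightarrow> u a \<in> pure_states m"
    and \<delta>: "\<And>a b. a \<in> F \<Longrightarrow> b \<in> F \<Longrightarrow> a \<noteq> b \<Longrightarrow> cmod (u a \<bullet>c u b) \<le> \<delta>"
  shows "overlap_moment t v \<le> 1 / card F + \<delta> ^ (2 * t)"
proof -
  define D where D: "D = ((2::nat) ^ m) ^ t"
  define w where "w a = vec_pow (u a) t" for a
  define B where "B = mat D D (\<lambda>(i, j). \<Sum>a\<in>F. w a $ i * cnj (w a $ j))"
  define K where "K = overlap_moment t v"
  have BC: "B \<in> carrier_mat D D" by (simp add: B_def)
  have uC: "u a \<in> carrier_vec (2 ^ m)" if "a \<in> F" for a using u[OF that] by (simp add: pure_states_def)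
  have wC: "w a \<in> carrier_vec D" if "a \<in> F" for a
    unfolding w_def D by (rule vec_pow_carrier[OF uC[OF that]])
  have overlap: "cmod (w a \<bullet>c w b) = cmod (u a \<bullet>c u b) ^ t" if "a \<in> F" "b \<in> F" for a b
    unfolding w_def by (simp add: cscalar_prod_vec_pow[OF uC[OF that(1)] uC[OF that(2)]] norm_power)

  \<comment> \<open>The quadratic form of \<open>B\<close> splits into one overlap per packing
    vector, and by invariance each has the same average \<open>K\<close>.\<close>
  have "(\<integral>\<theta>. (B *\<^sub>v vec_pow \<theta> t) \<bullet>c vec_pow \<theta> t \<partial>H) =
      (\<integral>\<theta>. of_real (\<Sum>a\<in>F. cmod (\<theta> \<bullet>c u a) ^ (2 * t)) \<partial>H)"
  proof (intro Bochner_Integration.integral_cong refl)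
    fix \<theta> assume "\<theta> \<in> space H"
    hence \<theta>: "\<theta> \<in> carrier_vec (2 ^ m)" by (simp add: space_H pure_states_def)
    define x where "x = vec_pow \<theta> t"
    have xC: "x \<in> carrier_vec D" unfolding x_def D by (rule vec_pow_carrier[OF \<theta>])
    have "(B *\<^sub>v x) \<bullet>c x = (\<Sum>i<D. \<Sum>j<D. (\<Sum>a\<in>F. w a $ i * cnj (w a $ j)) * (x $ j * cnj (x $ i)))"
      unfolding cscalar_prod_mult_eq_sum[OF BC xC] by (intro sum.cong) (auto simp: B_def)
    also have "\<dots> = (\<Sum>i<D. \<Sum>a\<in>F. \<Sum>j<D. w a $ i * cnj (w a $ j) * (x $ j * cnj (x $ i)))"
      unfolding sum_distrib_right by (intro sum.cong refl, rule sum.swap)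
    also have "\<dots> = (\<Sum>a\<in>F. \<Sum>i<D. \<Sum>j<D. w a $ i * cnj (w a $ j) * (x $ j * cnj (x $ i)))"
      by (rule sum.swap)
    also have "\<dots> = (\<Sum>a\<in>F. (w a \<bullet>c x) * (x \<bullet>c w a))"
    proof (intro sum.cong refl)
      fix a assume a: "a \<in> F"
      show "(\<Sum>i<D. \<Sum>j<D. w a $ i * cnj (w a $ j) * (x $ j * cnj (x $ i))) = (w a \<bullet>c x) * (x \<bullet>c w a)"
        unfolding cscalar_prod_eq_sum[OF wC[OF a] xC] cscalar_prod_eq_sum[OF xC wC[OF a]] sum_product
        by (intro sum.cong refl) (simp add: mult_ac)
    qed
    also have "\<dots> = (\<Sum>a\<in>F. of_real (cmod (\<theta> \<bullet>c u a) ^ (2 * t)))"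
    proof (intro sum.cong refl)
      fix a assume a: "a \<in> F"
      have "(w a \<bullet>c x) * (x \<bullet>c w a) = of_real ((cmod (x \<bullet>c w a))\<^sup>2)"
        using cnj_cscalar_prod[OF xC wC[OF a]]
        by (simp add: complex_norm_square mult.commute del: of_real_power)
      also have "(cmod (x \<bullet>c w a))\<^sup>2 = cmod (\<theta> \<bullet>c u a) ^ (2 * t)"
        unfolding x_def w_def
        by (simp add: cscalar_prod_vec_pow[OF \<theta> uC[OF a]] norm_power power_mult[symmetric] mult.commute)
      finally show "(w a \<bullet>c x) * (x \<bullet>c w a) = of_real (cmod (\<theta> \<bullet>c u a) ^ (2 * t))" .
    qed
    finally show "(B *\<^sub>v vec_pow \<theta> t) \<bullet>c vec_pow \<theta> t = of_real (\<Sum>a\<in>F. cmod (\<theta> \<bullet>c u a) ^ (2 * t))"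
      by (simp add: x_def)
  qed
  also have "\<dots> = of_real (\<Sum>a\<in>F. overlap_moment t (u a))"
  proof -
    have "integrable H (\<lambda>\<theta>. \<Sum>a\<in>F. cmod (\<theta> \<bullet>c u a) ^ (2 * t))"
      using overlap_integrable u by (intro Bochner_Integration.integrable_sum) auto
    hence "(\<integral>\<theta>. complex_of_real (\<Sum>a\<in>F. cmod (\<theta> \<bullet>c u a) ^ (2 * t)) \<partial>H) =
        of_real (\<integral>\<theta>. (\<Sum>a\<in>F. cmod (\<theta> \<bullet>c u a) ^ (2 * t)) \<partial>H)"
      by (rule integral_of_real)
    thus ?thesis unfolding overlap_moment_def
      using overlap_integrable u by (subst (asm) Bochner_Integration.integral_sum) auto
  qed
  also have "\<dots> = of_real (card F * K)"
    using overlap_moment_eq[OF u v] by (simp add: K_def)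
  finally have expectation: "(\<integral>\<theta>. (B *\<^sub>v vec_pow \<theta> t) \<bullet>c vec_pow \<theta> t \<partial>H) = of_real (card F * K)" .

  \<comment> \<open>Moving the sums over \<open>i\<close> and \<open>j\<close> innermost turns the
    squared norm of \<open>B\<close> into the sum of all squared entries of the Gram matrix of the
    \<open>w a\<close>.\<close>
  have "complex_of_real (frob B) = (\<Sum>i<D. \<Sum>j<D. B $$ (i, j) * cnj (B $$ (i, j)))"
    using BC by (simp add: frob_def complex_norm_square del: of_real_power)
  also have "\<dots> = (\<Sum>i<D. \<Sum>j<D. \<Sum>a\<in>F. \<Sum>b\<in>F.
      (w a $ i * cnj (w b $ i)) * (w b $ j * cnj (w a $ j)))"
    by (intro sum.cong refl) (simp add: B_def sum_product mult_ac)
  also have "\<dots> = (\<Sum>i<D. \<Sum>a\<in>F. \<Sum>b\<in>F. \<Sum>j<D. (w a $ i * cnj (w b $ i)) * (w b $ j * cnj (w a $ j)))"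
    by (intro sum.cong refl, subst sum.swap, intro sum.cong refl, rule sum.swap)
  also have "\<dots> = (\<Sum>a\<in>F. \<Sum>b\<in>F. \<Sum>i<D. \<Sum>j<D. (w a $ i * cnj (w b $ i)) * (w b $ j * cnj (w a $ j)))"
    by (subst sum.swap, intro sum.cong refl, rule sum.swap)
  also have "\<dots> = (\<Sum>a\<in>F. \<Sum>b\<in>F. of_real ((cmod (w a \<bullet>c w b))\<^sup>2))"
  proof (intro sum.cong refl)
    fix a b assume ab: "a \<in> F" "b \<in> F"
    have "(\<Sum>i<D. \<Sum>j<D. (w a $ i * cnj (w b $ i)) * (w b $ j * cnj (w a $ j))) = (w a \<bullet>c w b) * (w b \<bullet>c w a)"
      using wC ab by (simp add: cscalar_prod_eq_sum[of _ D] sum_product)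
    also have "\<dots> = of_real ((cmod (w a \<bullet>c w b))\<^sup>2)"
      using cnj_cscalar_prod[OF wC[OF ab(1)] wC[OF ab(2)]]
      by (simp add: complex_norm_square del: of_real_power)
    finally show "(\<Sum>i<D. \<Sum>j<D. (w a $ i * cnj (w b $ i)) * (w b $ j * cnj (w a $ j))) =
      of_real ((cmod (w a \<bullet>c w b))\<^sup>2)" .
  qed
  finally have "complex_of_real (frob B) = of_real (\<Sum>a\<in>F. \<Sum>b\<in>F. (cmod (w a \<bullet>c w b))\<^sup>2)" by simp
  hence "frob B = (\<Sum>a\<in>F. \<Sum>b\<in>F. (cmod (w a \<bullet>c w b))\<^sup>2)" using of_real_eq_iff by blast
  \<comment> \<open>A diagonal entry is exactly 1; the even exponent makes the extra \<delta> term
    nonnegative there.\<close>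
  also have "\<dots> \<le> (\<Sum>a\<in>F. \<Sum>b\<in>F. (if a = b then 1 else 0) + \<delta> ^ (2 * t))"
  proof (intro sum_mono)
    fix a b assume ab: "a \<in> F" "b \<in> F"
    have sq: "(cmod (w a \<bullet>c w b))\<^sup>2 = cmod (u a \<bullet>c u b) ^ (2 * t)"
      by (simp add: overlap[OF ab] power_mult[symmetric] mult.commute)
    show "(cmod (w a \<bullet>c w b))\<^sup>2 \<le> (if a = b then 1 else 0) + \<delta> ^ (2 * t)"
    proof (cases "a = b")
      case True
      have "u a \<bullet>c u a = 1" using u[OF ab(1)] by (simp add: pure_states_def)
      thus ?thesis using True sq by (simp add: power_mult)
    next
      case False
      show ?thesis unfolding sq using False \<delta>[OF ab False] by (auto intro!: power_mono)
    qed
  qed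
  also have "\<dots> = card F + (card F)\<^sup>2 * \<delta> ^ (2 * t)"
    using F by (simp add: sum.distrib power2_eq_square algebra_simps)
  finally have frobB: "frob B \<le> card F + (card F)\<^sup>2 * \<delta> ^ (2 * t)" .

  have K0: "0 \<le> K" unfolding K_def by (rule overlap_moment_nonneg)
  have L: "real (card F) > 0" using F by (simp add: card_gt_0_iff)
  have "(card F * K)\<^sup>2 \<le> frob B * K"
    using expectation_le_frob[OF v BC[unfolded D]] unfolding expectation norm_of_real K_def by simp
  also have "\<dots> \<le> (card F + (card F)\<^sup>2 * \<delta> ^ (2 * t)) * K"
    by (rule mult_right_mono[OF frobB K0])
  finally have *: "(card F)\<^sup>2 * K * K \<le> (card F + (card F)\<^sup>2 * \<delta> ^ (2 * t)) * K"
    by (simp add: power_mult_distrib power2_eq_square mult_ac)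
  show ?thesis
  \<comment> \<open>The factor \<open>K\<close> can be cancelled only if it is nonzero; otherwise
    the bound is trivial.\<close>
  proof (cases "K = 0")
    case True
    thus ?thesis using L unfolding K_def[symmetric] by (simp add: power_mult)
  next
    case False
    hence "(card F)\<^sup>2 * K \<le> card F + (card F)\<^sup>2 * \<delta> ^ (2 * t)"
      using * K0 by (simp add: mult_le_cancel_right)
    hence "real (card F) * (card F * K) \<le> real (card F) * (1 + card F * \<delta> ^ (2 * t))"
      by (simp add: algebra_simps power2_eq_square)
    hence "card F * K \<le> 1 + card F * \<delta> ^ (2 * t)"
      using L by (simp only: mult_le_cancel_left_pos)
    thus ?thesis using L unfolding K_def[symmetric] by (simp add: field_simps)
  qed
qed

end


section \<open>Phase states\<close>

text \<open>Four phases per coordinate give \<open>4 ^ (N - 1)\<close> vectors, which outgrows the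
  projector rank \<open>2 ^ N\<close>; signs alone would give \<open>2 ^ (N - 1)\<close>, too few to
  make the product of rank and moment small.\<close>

definition fourth_roots :: "complex set" where
  "fourth_roots = {1, \<i>, -1, -\<i>}"

lemma card_fourth_roots: "card fourth_roots = 4"
  by (simp add: fourth_roots_def complex_eq_iff)

lemma finite_fourth_roots: "finite fourth_roots"
  by (simp add: fourth_roots_def)

lemma cmod_fourth_root: "z \<in> fourth_roots \<Longrightarrow> cmod z = 1"
  by (auto simp: fourth_roots_def)

text \<open>The product is a fourth root of unity other than 1, so the modulus is 0 or the square
  root of 2; 3/2 is a rational bound for both.\<close>

lemma cmod_one_plus_fourth_roots_le:
  assumes "z \<in> fourth_roots" "w \<in> fourth_roots" "z \<noteq> w"
  shows "cmod (1 + z * cnj w) \<le> 3 / 2"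
proof -
  have sqrt2: "sqrt 2 \<le> 3 / 2" by (rule real_le_lsqrt) (auto simp: power2_eq_square)
  have "cmod (1 + y) \<le> 3 / 2" if "y \<in> {\<i>, -1, -\<i>}" for y
    using that sqrt2 by (auto simp: cmod_def)
  moreover have "z * cnj w \<in> {\<i>, -1, -\<i>}"
    using assms by (auto simp: fourth_roots_def)
  ultimately show ?thesis by blast
qed

text \<open>Coordinates 0 and \<open>j\<close> together contribute at most 3/2 rather than 2, and
  each of the other \<open>N - 2\<close> at most 1.\<close>

lemma fourth_roots_overlap_le:
  fixes x y :: "nat \<Rightarrow> complex"
  assumes x: "\<And>i. i < N \<Longrightarrow> x i \<in> fourth_roots" and y: "\<And>i. i < N \<Longrightarrow> y i \<in> fourth_roots"
    and 0: "x 0 = 1" "y 0 = 1" and j: "j < N" "x j \<noteq> y j"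
  shows "cmod (\<Sum>i<N. x i * cnj (y i)) \<le> real N - 1 / 2"
proof -
  have j0: "j \<noteq> 0" using 0 j by metis
  let ?R = "{..<N} - {0, j}"
  have N: "N \<ge> 2" using j j0 by linarith
  have "{..<N} = insert 0 (insert j ?R)" using j by auto
  hence "(\<Sum>i<N. x i * cnj (y i)) = (\<Sum>i\<in>insert 0 (insert j ?R). x i * cnj (y i))" by simp
  also have "\<dots> = (1 + x j * cnj (y j)) + (\<Sum>i\<in>?R. x i * cnj (y i))"
    using j0 0 by (subst sum.insert; simp)
  also have "cmod \<dots> \<le> cmod (1 + x j * cnj (y j)) + (\<Sum>i\<in>?R. cmod (x i * cnj (y i)))"
    by (rule order_trans[OF norm_triangle_ineq]) (intro add_left_mono norm_sum)
  also have "(\<Sum>i\<in>?R. cmod (x i * cnj (y i))) = (\<Sum>i\<in>?R. 1)"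
    by (intro sum.cong refl) (auto simp: norm_mult cmod_fourth_root x y)
  also have "\<dots> = real N - 2"
    using j j0 N by (simp add: card_Diff_subset)
  also have "cmod (1 + x j * cnj (y j)) \<le> 3 / 2"
    using x[OF j(1)] y[OF j(1)] j(2) by (rule cmod_one_plus_fourth_roots_le)
  finally show ?thesis by simp
qed

text \<open>Coordinate 0 is forced to be 1: otherwise vectors differing by a global phase would have overlap 1.\<close>

definition phase_state :: "nat \<Rightarrow> nat \<Rightarrow> (nat \<Rightarrow> complex) \<Rightarrow> complex vec" where
  "phase_state m N x =
     vec (2 ^ m) (\<lambda>i. if i < N then (x(0 := 1)) i / complex_of_real (sqrt (real N)) else 0)"

lemma cscalar_prod_phase_state:
  assumes N: "N \<le> 2 ^ m"
  shows "phase_state m N x \<bullet>c phase_state m N y =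
    (\<Sum>i<N. (x(0 := 1)) i * cnj ((y(0 := 1)) i)) / of_nat N"
proof -
  have C: "phase_state m N z \<in> carrier_vec (2 ^ m)" for z by (simp add: phase_state_def)
  let ?x = "x(0 := 1)" and ?y = "y(0 := 1)"
  have "complex_of_real (sqrt (real N)) * complex_of_real (sqrt (real N)) = of_nat N"
    by (metis abs_of_nat of_real_mult of_real_of_nat_eq real_sqrt_mult_self)
  hence sq: "a / complex_of_real (sqrt (real N)) * cnj (b / complex_of_real (sqrt (real N))) =
      a * cnj b / of_nat N" for a b
    by simp
  have "phase_state m N x \<bullet>c phase_state m N y =
      (\<Sum>i<2 ^ m. if i < N then ?x i * cnj (?y i) / of_nat N else 0)"
    unfolding cscalar_prod_eq_sum[OF C C]
  proof (intro sum.cong refl)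
    fix i :: nat assume "i \<in> {..<2 ^ m}"
    hence idx: "phase_state m N z $ i = (if i < N then (z(0 := 1)) i / complex_of_real (sqrt (real N)) else 0)"
      for z by (simp add: phase_state_def)
    show "phase_state m N x $ i * cnj (phase_state m N y $ i) =
        (if i < N then ?x i * cnj (?y i) / of_nat N else 0)"
      by (cases "i < N") (simp_all only: idx sq if_True if_False mult_zero_left)
  qed
  also have "\<dots> = (\<Sum>i<N. ?x i * cnj (?y i) / of_nat N)"
    using N by (intro sum.mono_neutral_cong_right) auto
  finally show ?thesis by (simp only: sum_divide_distrib)
qed

lemma phase_state_pure:
  assumes "0 < N" "N \<le> 2 ^ m" "\<And>i. i \<in> {1..<N} \<Longrightarrow> x i \<in> fourth_roots"
  shows "phase_state m N x \<in> pure_states m"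
proof -
  have "(x(0 := 1)) i * cnj ((x(0 := 1)) i) = 1" if "i < N" for i
    using assms(3)[of i] that by (auto simp: fourth_roots_def)
  hence "(\<Sum>i<N. (x(0 := 1)) i * cnj ((x(0 := 1)) i)) = of_nat N" by simp
  thus ?thesis
    using assms(1) cscalar_prod_phase_state[OF assms(2)] by (simp add: pure_states_def phase_state_def)
qed

lemma phase_state_overlap_le:
  assumes "0 < N" "N \<le> 2 ^ m"
    and x: "x \<in> {1..<N} \<rightarrow>\<^sub>E fourth_roots" and y: "y \<in> {1..<N} \<rightarrow>\<^sub>E fourth_roots" and "x \<noteq> y"
  shows "cmod (phase_state m N x \<bullet>c phase_state m N y) \<le> 1 - 1 / (2 * real N)"
proof -
  \<comment> \<open>Extensionality places a difference inside \<open>{1..<N}\<close>, away from the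
    overwritten coordinate 0.\<close>
  obtain j where j: "j \<in> {1..<N}" "x j \<noteq> y j" using x y \<open>x \<noteq> y\<close> by (metis PiE_ext)
  have "cmod (\<Sum>i<N. (x(0 := 1)) i * cnj ((y(0 := 1)) i)) \<le> real N - 1 / 2"
    using x y j by (intro fourth_roots_overlap_le[of _ _ _ j]) (auto simp: fourth_roots_def PiE_def Pi_def)
  thus ?thesis using assms(1)
    by (simp add: cscalar_prod_phase_state[OF assms(2)] norm_divide field_simps del: fun_upd_apply)
qed

text \<open>From \<open>1 - x \<le> exp (- x)\<close> at \<open>x = 1 / (2 * N)\<close>, the
  exponent \<open>4 * N\<^sup>2\<close> leaves \<open>exp (- 2 * N)\<close>, and
  \<open>exp 2\<close> is at least 4. The exponent is twice the number \<open>2 * N\<^sup>2\<close>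
  of copies.\<close>

lemma one_minus_inverse_power_le:
  assumes "0 < N"
  shows "(1 - 1 / (2 * real N)) ^ (2 * (2 * N\<^sup>2)) \<le> 1 / 4 ^ N"
proof -
  have "1 / (2 * real N) \<le> 1" using assms by simp
  hence "(1 - 1 / (2 * real N)) ^ (2 * (2 * N\<^sup>2)) \<le> exp (- (1 / (2 * real N))) ^ (2 * (2 * N\<^sup>2))"
    using exp_ge_add_one_self[of "- (1 / (2 * real N))"] by (intro power_mono) auto
  also have "\<dots> = exp (- (2 * real N))"
    using assms unfolding exp_of_nat_mult[symmetric]
    by (intro arg_cong[where f = exp]) (simp add: field_simps power2_eq_square)
  also have "\<dots> = 1 / exp 2 ^ N"
    by (simp add: exp_minus inverse_eq_divide exp_of_nat_mult[symmetric] mult.commute)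
  also have "\<dots> \<le> 1 / 4 ^ N"
  proof -
    have "(2::real) ^ 2 \<le> exp 1 ^ 2" using exp_ge_add_one_self[of 1] by (intro power_mono) auto
    hence "4 \<le> exp (2::real)" by (simp add: exp_of_nat_mult[symmetric])
    thus ?thesis by (intro divide_left_mono power_mono) auto
  qed
  finally show ?thesis .
qed

lemma (in haar_states) overlap_moment_le:
  assumes N: "0 < N" "N \<le> 2 ^ m" and v: "v \<in> pure_states m"
  shows "overlap_moment (2 * N\<^sup>2) v \<le> 5 / 4 ^ N"
proof -
  let ?F = "{1..<N} \<rightarrow>\<^sub>E fourth_roots"
  have card: "card ?F = 4 ^ (N - 1)"
    by (simp add: card_PiE card_fourth_roots)
  have "overlap_moment (2 * N\<^sup>2) v \<le> 1 / card ?F + (1 - 1 / (2 * real N)) ^ (2 * (2 * N\<^sup>2))"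
  proof (rule overlap_moment_le_packing[OF v, where u = "phase_state m N"])
    show "finite ?F" by (simp add: finite_PiE finite_fourth_roots)
    have "card ?F \<noteq> 0" unfolding card by simp
    thus "?F \<noteq> {}" by (metis card.empty)
    show "phase_state m N x \<in> pure_states m" if "x \<in> ?F" for x
      using that by (intro phase_state_pure N) auto
  qed (rule phase_state_overlap_le[OF N])
  also have "\<dots> \<le> 1 / 4 ^ (N - 1) + 1 / 4 ^ N"
    unfolding card using one_minus_inverse_power_le[OF N(1)] by simp
  \<comment> \<open>The packing term is \<open>4 / 4 ^ N\<close>, as only \<open>N - 1\<close>
    coordinates are free, and the overlap term adds one more unit.\<close>
  also have "\<dots> = 5 / 4 ^ N"
    using N by (cases N) (auto simp: field_simps)
  finally show ?thesis .
qed


section \<open>The distinguishing measurement\<close>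

lemma card_bitstrings: "card (bitstrings \<kappa>) = 2 ^ \<kappa>"
  using card_lists_length_eq[of "UNIV :: bool set" \<kappa>] by (simp add: bitstrings_def)

lemma finite_bitstrings: "finite (bitstrings \<kappa>)"
  by (metis card_bitstrings card.infinite power_eq_0_iff zero_neq_numeral)

text \<open>Each key state's tensor power is a unit vector fixed by the projector onto their span,
  so it is accepted with certainty. The rank is at most the number of keys, and coinciding states
  only lower it.\<close>

lemma exists_accepting_projector:
  assumes "\<And>k. k \<in> bitstrings \<kappa> \<Longrightarrow> \<exists>\<psi>\<in>pure_states m. \<rho> k = ket_bra \<psi>"
  shows "\<exists>P. projector (2 ^ (t * m)) P \<and> frob P \<le> 2 ^ \<kappa> \<and>
    (\<forall>k\<in>bitstrings \<kappa>. outcome_prob P (tensor_pow (\<rho> k) t) = 1)"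
proof -
  obtain \<psi> where \<psi>: "\<And>k. k \<in> bitstrings \<kappa> \<Longrightarrow> \<psi> k \<in> pure_states m"
    "\<And>k. k \<in> bitstrings \<kappa> \<Longrightarrow> \<rho> k = ket_bra (\<psi> k)"
    using assms by metis
  have D: "(2::nat) ^ (t * m) = (2 ^ m) ^ t" by (simp add: power_mult[symmetric] mult.commute)
  have \<psi>C: "\<psi> k \<in> carrier_vec (2 ^ m)" if "k \<in> bitstrings \<kappa>" for k
    using \<psi>(1)[OF that] by (simp add: pure_states_def)
  define S where "S = (\<lambda>k. vec_pow (\<psi> k) t) ` bitstrings \<kappa>"
  have "finite S" unfolding S_def by (intro finite_imageI finite_bitstrings)
  moreover have "S \<subseteq> carrier_vec (2 ^ (t * m))"
    unfolding S_def D by (intro image_subsetI vec_pow_carrier \<psi>C)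
  ultimately obtain P where P: "projector (2 ^ (t * m)) P" "\<And>v. v \<in> S \<Longrightarrow> P *\<^sub>v v = v" "frob P \<le> card S"
    using projector_onto_span[of S "2 ^ (t * m)"] by auto
  have "real (card S) \<le> 2 ^ \<kappa>"
    unfolding S_def using card_image_le[OF finite_bitstrings, of "\<lambda>k. vec_pow (\<psi> k) t" \<kappa>]
    by (simp add: card_bitstrings)
  with P(3) have "frob P \<le> 2 ^ \<kappa>" by (rule order_trans)
  moreover have "outcome_prob P (tensor_pow (\<rho> k) t) = 1" if k: "k \<in> bitstrings \<kappa>" for k
  proof -
    have PC: "P \<in> carrier_mat ((2 ^ m) ^ t) ((2 ^ m) ^ t)"
      using P(1) by (simp add: projector_def D)
    have "outcome_prob P (tensor_pow (\<rho> k) t) = Re (vec_pow (\<psi> k) t \<bullet>c vec_pow (\<psi> k) t)"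
      using outcome_prob_tensor_pow[OF PC \<psi>C[OF k]] P(2)[of "vec_pow (\<psi> k) t"] k
      by (simp add: \<psi>(2) S_def)
    also have "\<dots> = 1"
      using \<psi>(1)[OF k] by (simp add: cscalar_prod_vec_pow[OF \<psi>C[OF k] \<psi>C[OF k]] pure_states_def)
    finally show ?thesis .
  qed
  ultimately show ?thesis using P(1) by blast
qed

theorem lemma6p1:
  fixes H :: "nat \<Rightarrow> complex vec measure"
    and n :: "nat \<Rightarrow> nat"
    and G :: "nat \<Rightarrow> qcircuit"
  assumes haar: "\<And>m. haar_measure m (H m)"
    and prs: "PRS_generator H n G"
    and len: "\<And>\<kappa>. \<kappa> > 0 \<Longrightarrow> real (n \<kappa>) \<ge> log 2 (real \<kappa>)"
  shows "\<exists>(t :: nat poly) (A :: nat \<Rightarrow> complex mat).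
           (\<forall>\<kappa>. two_outcome_measurement (poly t \<kappa> * n \<kappa>) (A \<kappa>)) \<and>
           (\<forall>\<^sub>F \<kappa> in sequentially.
              \<bar>measure_pmf.expectation (pmf_of_set (bitstrings \<kappa>))
                  (\<lambda>k. outcome_prob (A \<kappa>) (tensor_pow (gen_state G \<kappa> k) (poly t \<kappa>)))
               - (\<integral>\<theta>. outcome_prob (A \<kappa>) (tensor_pow (ket_bra \<theta>) (poly t \<kappa>)) \<partial>H (n \<kappa>))\<bar>
              \<ge> 1 / 3)"
proof -
  \<comment> \<open>Coefficients are listed from degree 0, so this is twice the square.\<close>
  define t :: "nat poly" where "t = [:0, 0, 2:]"
  have poly_t: "poly t \<kappa> = 2 * \<kappa>\<^sup>2" for \<kappa> by (simp add: t_def power2_eq_square)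
  have "\<exists>P. projector (2 ^ (poly t \<kappa> * n \<kappa>)) P \<and> frob P \<le> 2 ^ \<kappa> \<and>
      (\<forall>k\<in>bitstrings \<kappa>. outcome_prob P (tensor_pow (gen_state G \<kappa> k) (poly t \<kappa>)) = 1)" for \<kappa>
    using prs by (intro exists_accepting_projector) (auto simp: PRS_generator_def)
  then obtain A where A: "\<And>\<kappa>. projector (2 ^ (poly t \<kappa> * n \<kappa>)) (A \<kappa>)" "\<And>\<kappa>. frob (A \<kappa>) \<le> 2 ^ \<kappa>"
    "\<And>\<kappa> k. k \<in> bitstrings \<kappa> \<Longrightarrow> outcome_prob (A \<kappa>) (tensor_pow (gen_state G \<kappa> k) (poly t \<kappa>)) = 1"
    by metis
  have "\<bar>measure_pmf.expectation (pmf_of_set (bitstrings \<kappa>))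
          (\<lambda>k. outcome_prob (A \<kappa>) (tensor_pow (gen_state G \<kappa> k) (poly t \<kappa>)))
        - (\<integral>\<theta>. outcome_prob (A \<kappa>) (tensor_pow (ket_bra \<theta>) (poly t \<kappa>)) \<partial>H (n \<kappa>))\<bar> \<ge> 1 / 3"
    if \<kappa>: "\<kappa> \<ge> 4" for \<kappa>
  proof -
    interpret haar_states "n \<kappa>" "H (n \<kappa>)" by unfold_locales (rule haar)
    have "bitstrings \<kappa> \<noteq> {}" by (metis card.empty card_bitstrings power_not_zero zero_neq_numeral)
    hence "measure_pmf.expectation (pmf_of_set (bitstrings \<kappa>))
          (\<lambda>k. outcome_prob (A \<kappa>) (tensor_pow (gen_state G \<kappa> k) (poly t \<kappa>))) =
        measure_pmf.expectation (pmf_of_set (bitstrings \<kappa>)) (\<lambda>k. 1)"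
      by (intro integral_cong_AE) (auto simp: AE_measure_pmf_iff A(3) finite_bitstrings)
    hence keys: "measure_pmf.expectation (pmf_of_set (bitstrings \<kappa>))
          (\<lambda>k. outcome_prob (A \<kappa>) (tensor_pow (gen_state G \<kappa> k) (poly t \<kappa>))) = 1" by simp
    define x where "x = (\<integral>\<theta>. outcome_prob (A \<kappa>) (tensor_pow (ket_bra \<theta>) (poly t \<kappa>)) \<partial>H (n \<kappa>))"
    have "real \<kappa> \<le> 2 powr real (n \<kappa>)"
      using len[of \<kappa>] \<kappa> by (simp add: log_le_iff)
    hence "real \<kappa> \<le> real (2 ^ n \<kappa>)" by (simp add: powr_realpow)
    hence N: "\<kappa> \<le> 2 ^ n \<kappa>" by (simp only: of_nat_le_iff)
    \<comment> \<open>The sphere carries a probability measure and is therefore inhabited; any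
      reference state will do.\<close>
    obtain v where v: "v \<in> pure_states (n \<kappa>)" using not_empty space_H by auto
    have C: "A \<kappa> \<in> carrier_mat ((2 ^ n \<kappa>) ^ poly t \<kappa>) ((2 ^ n \<kappa>) ^ poly t \<kappa>)"
      using A(1)[of \<kappa>] by (simp add: projector_def power_mult[symmetric] mult.commute)
    have "x\<^sup>2 \<le> frob (A \<kappa>) * overlap_moment (poly t \<kappa>) v"
      unfolding x_def by (rule expected_outcome_prob_le[OF v C])
    also have "\<dots> \<le> 2 ^ \<kappa> * (5 / 4 ^ \<kappa>)"
      using A(2)[of \<kappa>] overlap_moment_le[OF _ N v] \<kappa> overlap_moment_nonneg
      by (intro mult_mono) (auto simp: poly_t)
    also have "\<dots> = 5 / 2 ^ \<kappa>"
      by (simp add: power_mult_distrib[symmetric] field_simps)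
    \<comment> \<open>The threshold 4 is the first that works: 5/16 is below 4/9 while 5/8 is not. A
      Haar acceptance of at most 2/3 leaves the gap 1/3.\<close>
    also have "\<dots> \<le> 5 / 2 ^ 4"
      using \<kappa> by (intro divide_left_mono power_increasing) auto
    also have "\<dots> \<le> (2 / 3)\<^sup>2" by (simp add: power2_eq_square)
    finally have "x \<le> 2 / 3" by (rule power2_le_imp_le) simp
    thus ?thesis unfolding keys x_def[symmetric] by simp
  qed
  hence "\<forall>\<^sub>F \<kappa> in sequentially.
      \<bar>measure_pmf.expectation (pmf_of_set (bitstrings \<kappa>))
          (\<lambda>k. outcome_prob (A \<kappa>) (tensor_pow (gen_state G \<kappa> k) (poly t \<kappa>)))
        - (\<integral>\<theta>. outcome_prob (A \<kappa>) (tensor_pow (ket_bra \<theta>) (poly t \<kappa>)) \<partial>H (n \<kappa>))\<bar> \<ge> 1 / 3"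
    by (rule eventually_sequentiallyI)
  moreover have "\<forall>\<kappa>. two_outcome_measurement (poly t \<kappa> * n \<kappa>) (A \<kappa>)"
    using two_outcome_measurement_projector A(1) by blast
  ultimately show ?thesis by blast
qed

end
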